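(* Let $\{\varphi_i\}_{i\in\Lambda}$ be a self-conformal iterated function system on $\mathbb{R}^d$ whose limit set $F$ satisfies the strong separation condition, and let $\mu$ be a quasi-Bernoulli measure fully supported on $F$. Then $$\dim_{\mathrm{A}}(\mu,x)=\dim_{\mathrm{A}}\mu<\infty$$ for $\mu$-almost every $x\in F$.
   Context: Dimensions of measures. Let $\mu$ be a finite Borel measure fully supported on a metric space $X$ (here $X=F$ with the Euclidean metric), and let $B(x,r)$ denote the closed ball in $X$. The (global) Assouad dimension of $\mu$ is $$\dim_{\mathrm{A}}\mu=\inf\Big\{s>0:\exists C>0 \text{ such that for all } x\in X,\ 0<r<R,\ \tfrac{\mu(B(x,R))}{\mu(B(x,r))}\le C\big(\tfrac{R}{r}\big)^s\Big\},$$ and the pointwise Assouad dimension of $\mu$ at $x\in X$ is $$\dim_{\mathrm{A}}(\mu,x)=\inf\Big\{s>0:\exists C(x)>0 \text{ such that for all } 0<r<R,\ \tfrac{\mu(B(x,R))}{\mu(B(x,r))}\le C(x)\big(\tfrac{R}{r}\big)^s\Big\}$$ (with $\inf\emptyset=\infty$). Self-conformal IFS. $\Lambda$ is a finite index set and $\{\varphi_i\}_{i\in\Lambda}$ is a family of contractions satisfying: (C1) there are an open, bounded, connected set $\Omega\subset\mathbb{R}^d$ and a compact set $X_0\subset\Omega$ with non-empty interior such that $\varphi_i(X_0)\subset X_0$ for all $i\in\Lambda$; (C2) each $\varphi_i:\Omega\to\Omega$ is a $C^{1+\varepsilon}$-diffeomorphism (onto its image, with Hölder continuous derivative), contractive on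 $\Omega$, and conformal, i.e. for every $x\in\Omega$ the linear map $\varphi_i'(x)$ is a similarity: $|\varphi_i'(x)y|=|\varphi_i'(x)||y|$ for all $y$, where $|\varphi_i'(x)|$ is the operator norm. The limit set $F$ is the unique non-empty compact set with $F=\bigcup_{i\in\Lambda}\varphi_i(F)$; it is called a self-conformal set. The strong separation condition (SSC) means $\varphi_i(F)\cap\varphi_j(F)=\emptyset$ for all distinct $i,j\in\Lambda$. Symbolic notation. $\Sigma=\Lambda^{\mathbb{N}}$ is the set of infinite words, $\Sigma_*$ is the set of all finite words (including the empty word), $[\mathbf{i}]\subset\Sigma$ is the cylinder of infinite words beginning with $\mathbf{i}\in\Sigma_*$, $\mathbf{i}\mathbf{j}$ is concatenation, $\mathbf{i}|_n$ is the word of the first $n$ letters of $\mathbf{i}$, and $\varphi_{\mathbf{i}|_n}=\varphi_{i_1}\circ\cdots\circ\varphi_{i_n}$. The coding map $\pi:\Sigma\to F$ is given by $\{\pi(\mathbf{i})\}=\bigcap_{n=1}^\infty\varphi_{\mathbf{i}|_n}(F)$. Quasi-Bernoulli measures. A Borel probability measure $\nu$ on $\Sigma$ is quasi-Bernoulli if there is a constant $C\ge1$ such that $C^{-1}\nu([\mathbf{i}])\nu([\mathbf{j}])\le\nu([\mathbf{i}\mathbf{j}])\le C\nu([\mathbf{i}])\nu([\mathbf{j}])$ for all $\mathbf{i},\mathbf{j}\in\Sigma_*$. A measure $\mu$ on $F$ is quasi-Bernoulli if $\mu=\pi_*\nu$ for some quasi-Bernoulli $\nu$ on $\Sigma$.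 Fully supported on $F$ means $\mathrm{supp}(\mu)=F$. *)

theory Defs
  imports "HOL-Probability.Probability"
begin

section \<open>Assouad dimensions of measures\<close>

text \<open>
  A measure \<open>\<mu>\<close> on the metric space \<open>X \<subseteq> 'a\<close> has \<open>space \<mu> = X\<close>; the closed balls of \<open>X\<close> are the
  sets \<open>cball x r \<inter> X\<close>. For fully supported \<open>\<mu>\<close> the denominators below are positive.
  The infima are taken in \<^typ>\<open>ereal\<close>, where \<open>Inf {} = \<infinity>\<close>.
\<close>

definition assouad_dim :: "'a::metric_space set \<Rightarrow> 'a measure \<Rightarrow> ereal" where
  "assouad_dim X \<mu> = Inf {ereal s | s. s > 0 \<and>
     (\<exists>C>0. \<forall>x\<in>X. \<forall>r R. 0 < r \<and> r < R \<longrightarrow>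
        measure \<mu> (cball x R \<inter> X) / measure \<mu> (cball x r \<inter> X) \<le> C * (R / r) powr s)}"

definition pointwise_assouad_dim :: "'a::metric_space set \<Rightarrow> 'a measure \<Rightarrow> 'a \<Rightarrow> ereal" where
  "pointwise_assouad_dim X \<mu> x = Inf {ereal s | s. s > 0 \<and>
     (\<exists>C>0. \<forall>r R. 0 < r \<and> r < R \<longrightarrow>
        measure \<mu> (cball x R \<inter> X) / measure \<mu> (cball x r \<inter> X) \<le> C * (R / r) powr s)}"

definition measure_support :: "'a::topological_space set \<Rightarrow> 'a measure \<Rightarrow> 'a set" where
  "measure_support X \<mu> =
     {x \<in> X. \<forall>U. openin (top_of_set X) U \<and> x \<in> U \<longrightarrow> emeasure \<mu> U > 0}"

definition fully_supported_on :: "'a::topological_space set \<Rightarrow> 'a measure \<Rightarrow> bool" where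
  "fully_supported_on X \<mu> \<longleftrightarrow> measure_support X \<mu> = X"


section \<open>Self-conformal iterated function systems\<close>

definition holder_on :: "real \<Rightarrow> 'a::metric_space set \<Rightarrow> ('a \<Rightarrow> 'b::metric_space) \<Rightarrow> bool" where
  "holder_on \<epsilon> S g \<longleftrightarrow> (\<exists>C\<ge>0. \<forall>x\<in>S. \<forall>y\<in>S. dist (g x) (g y) \<le> C * dist x y powr \<epsilon>)"

text \<open>
  \<open>f'\<close> is the derivative of \<open>f\<close>. The inverse is required to be continuously differentiable on the (open) image; no
  global Hoelder bound is imposed on the derivative of the inverse.
\<close>

definition C1_holder_diffeo_on ::
    "real \<Rightarrow> 'a::euclidean_space set \<Rightarrow> ('a \<Rightarrow> 'a) \<Rightarrow> ('a \<Rightarrow> 'a \<Rightarrow>\<^sub>L 'a) \<Rightarrow> bool" where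
  "C1_holder_diffeo_on \<epsilon> \<Omega> f f' \<longleftrightarrow>
     inj_on f \<Omega> \<and> open (f ` \<Omega>) \<and>
     (\<forall>x\<in>\<Omega>. (f has_derivative blinfun_apply (f' x)) (at x)) \<and>
     holder_on \<epsilon> \<Omega> f' \<and>
     (\<exists>g' :: 'a \<Rightarrow> 'a \<Rightarrow>\<^sub>L 'a.
        (\<forall>y\<in>f ` \<Omega>. (inv_into \<Omega> f has_derivative blinfun_apply (g' y)) (at y)) \<and>
        continuous_on (f ` \<Omega>) g')"

text \<open>The norm on \<^typ>\<open>'a \<Rightarrow>\<^sub>L 'a\<close> is the operator norm.\<close>

definition self_conformal_ifs ::
    "'i set \<Rightarrow> ('i \<Rightarrow> 'a::euclidean_space \<Rightarrow> 'a) \<Rightarrow> 'a set \<Rightarrow> 'a set \<Rightarrow> bool" where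
  "self_conformal_ifs \<Lambda> \<phi> \<Omega> X0 \<longleftrightarrow>
     finite \<Lambda> \<and>
     open \<Omega> \<and> bounded \<Omega> \<and> connected \<Omega> \<and>
     compact X0 \<and> X0 \<subseteq> \<Omega> \<and> interior X0 \<noteq> {} \<and>
     (\<forall>i\<in>\<Lambda>. \<phi> i ` X0 \<subseteq> X0) \<and>
     (\<exists>\<epsilon>>0. \<forall>i\<in>\<Lambda>.
        \<phi> i ` \<Omega> \<subseteq> \<Omega> \<and>
        (\<exists>c<1. c-lipschitz_on \<Omega> (\<phi> i)) \<and>
        (\<exists>f'. C1_holder_diffeo_on \<epsilon> \<Omega> (\<phi> i) f' \<and>
              (\<forall>x\<in>\<Omega>. \<forall>y. norm (blinfun_apply (f' x) y) = norm (f' x) * norm y)))"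

text \<open>
  The maps are only meaningful on \<open>\<Omega>\<close>, so the limit set is sought among subsets of \<open>\<Omega>\<close>, where it
  is unique because the maps contract \<open>\<Omega>\<close>.
\<close>

definition is_limit_set ::
    "'i set \<Rightarrow> ('i \<Rightarrow> 'a::euclidean_space \<Rightarrow> 'a) \<Rightarrow> 'a set \<Rightarrow> 'a set \<Rightarrow> bool" where
  "is_limit_set \<Lambda> \<phi> \<Omega> F \<longleftrightarrow>
     F \<subseteq> \<Omega> \<and> F \<noteq> {} \<and> compact F \<and> F = (\<Union>i\<in>\<Lambda>. \<phi> i ` F)"

definition strong_separation :: "'i set \<Rightarrow> ('i \<Rightarrow> 'a \<Rightarrow> 'a) \<Rightarrow> 'a set \<Rightarrow> bool" where
  "strong_separation \<Lambda> \<phi> F \<longleftrightarrow>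
     (\<forall>i\<in>\<Lambda>. \<forall>j\<in>\<Lambda>. i \<noteq> j \<longrightarrow> \<phi> i ` F \<inter> \<phi> j ` F = {})"


section \<open>Symbolic space and quasi-Bernoulli measures\<close>

text \<open>Infinite words are functions \<^typ>\<open>nat \<Rightarrow> 'i\<close> (indexed from 0), finite words are lists.\<close>

definition word_topology :: "'i set \<Rightarrow> (nat \<Rightarrow> 'i) topology" where
  "word_topology \<Lambda> = product_topology (\<lambda>_. discrete_topology \<Lambda>) UNIV"

definition word_borel :: "'i set \<Rightarrow> (nat \<Rightarrow> 'i) measure" where
  "word_borel \<Lambda> = sigma (topspace (word_topology \<Lambda>)) {U. openin (word_topology \<Lambda>) U}"

definition word_prefix :: "(nat \<Rightarrow> 'i) \<Rightarrow> nat \<Rightarrow> 'i list" where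
  "word_prefix \<omega> n = map \<omega> [0..<n]"

definition cylinder :: "'i set \<Rightarrow> 'i list \<Rightarrow> (nat \<Rightarrow> 'i) set" where
  "cylinder \<Lambda> w = {\<omega>. range \<omega> \<subseteq> \<Lambda> \<and> word_prefix \<omega> (length w) = w}"

definition word_map :: "('i \<Rightarrow> 'a \<Rightarrow> 'a) \<Rightarrow> 'i list \<Rightarrow> 'a \<Rightarrow> 'a" where
  "word_map \<phi> w = foldr (\<lambda>i g. \<phi> i \<circ> g) w id"

definition coding_map :: "('i \<Rightarrow> 'a \<Rightarrow> 'a) \<Rightarrow> 'a set \<Rightarrow> (nat \<Rightarrow> 'i) \<Rightarrow> 'a" where
  "coding_map \<phi> F \<omega> = the_elem (\<Inter>n\<in>{1..}. word_map \<phi> (word_prefix \<omega> n) ` F)"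

definition quasi_bernoulli :: "'i set \<Rightarrow> (nat \<Rightarrow> 'i) measure \<Rightarrow> bool" where
  "quasi_bernoulli \<Lambda> \<nu> \<longleftrightarrow>
     prob_space \<nu> \<and> space \<nu> = topspace (word_topology \<Lambda>) \<and> sets \<nu> = sets (word_borel \<Lambda>) \<and>
     (\<exists>C\<ge>1. \<forall>u\<in>lists \<Lambda>. \<forall>v\<in>lists \<Lambda>.
        inverse C * measure \<nu> (cylinder \<Lambda> u) * measure \<nu> (cylinder \<Lambda> v)
          \<le> measure \<nu> (cylinder \<Lambda> (u @ v)) \<and>
        measure \<nu> (cylinder \<Lambda> (u @ v))
          \<le> C * measure \<nu> (cylinder \<Lambda> u) * measure \<nu> (cylinder \<Lambda> v))"

definition quasi_bernoulli_on ::
    "'i set \<Rightarrow> ('i \<Rightarrow> 'a::euclidean_space \<Rightarrow> 'a) \<Rightarrow> 'a set \<Rightarrow> 'a measure \<Rightarrow> bool" where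
  "quasi_bernoulli_on \<Lambda> \<phi> F \<mu> \<longleftrightarrow>
     (\<exists>\<nu>. quasi_bernoulli \<Lambda> \<nu> \<and> \<mu> = distr \<nu> (restrict_space borel F) (coding_map \<phi> F))"

end

theory Submission
  imports Defs
begin

text \<open>
  By bounded distortion, \<open>\<phi>\<^sub>w\<close> is a similarity on \<open>F\<close> up to a uniform constant, with a ratio \<open>L(w)\<close>
  that is multiplicative up to constants. Under strong separation, balls of radius comparable
  to \<open>L(w)\<close> are therefore comparable to the pieces \<open>\<phi>\<^sub>w(F)\<close>, whose measure \<open>m(w)\<close> is quasi-multiplicative.
  Almost every \<open>x\<close> has a code containing every finite word \<open>v\<close>. If \<open>s\<close> is admissible at such an \<open>x\<close>,
  comparing the balls at the two ends of an occurrence of \<open>v\<close> gives \<open>m(v) \<ge> k * L(v)\<^sup>s\<close> with \<open>k\<close>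
  independent of \<open>v\<close>; by quasi-multiplicativity this makes \<open>s\<close> admissible at all points uniformly.
  Such a bound holds for some \<open>s\<close>, since \<open>m(v)\<close> decays at most and \<open>L(v)\<close> at least
  exponentially in the length of \<open>v\<close>.
\<close>

section \<open>Distortion of conformal maps\<close>

text \<open>Distortion is therefore phrased for pairs of points of \<open>F\<close>, as a comparison
  of products of distances. This form composes letter by letter, involves no derivative of a
  composition, and lets one fixed pair of distinct points serve as the gauge for
  \<open>L(w)\<close>; a one-point \<open>F\<close> has to be split off for this reason.

  The constant in the pointwise dimension depends on \<open>x\<close>, and nothing controls it. It
  need not be controlled: an occurrence of \<open>v\<close> behind a prefix \<open>u\<close>
  compares \<open>m(u)\<close> with \<open>m(uv)\<close>, and since \<open>m\<close> and
  \<open>L\<close> are multiplicative up to constants, \<open>u\<close> drops out wherever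
  \<open>v\<close> occurs. A single recurrent point thus bounds all pieces, with a constant that may
  depend on that point.\<close>

lemma C1_holder_diffeo_derivative_nonzero:
  fixes f :: "'a::euclidean_space \<Rightarrow> 'a"
  assumes diffeo: "C1_holder_diffeo_on \<epsilon> \<Omega> f f'" and "open \<Omega>" "x \<in> \<Omega>"
  shows "norm (f' x) > 0"
proof -
  obtain g' :: "'a \<Rightarrow> 'a \<Rightarrow>\<^sub>L 'a"
    where g': "\<And>y. y \<in> f ` \<Omega> \<Longrightarrow> (inv_into \<Omega> f has_derivative blinfun_apply (g' y)) (at y)"
    and f': "(f has_derivative blinfun_apply (f' x)) (at x)" and inj: "inj_on f \<Omega>"
    using diffeo \<open>x \<in> \<Omega>\<close> unfolding C1_holder_diffeo_on_def by blast
  \<comment> \<open>Conformality alone would allow a vanishing derivative. The differentiable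
    inverse excludes it: by the chain rule \<open>f' x\<close> has a left inverse.\<close>
  have "((inv_into \<Omega> f \<circ> f) has_derivative (blinfun_apply (g' (f x)) \<circ> blinfun_apply (f' x))) (at x)"
    using f' g' \<open>x \<in> \<Omega>\<close> by (intro diff_chain_at) auto
  then have "((\<lambda>z. z) has_derivative (blinfun_apply (g' (f x)) \<circ> blinfun_apply (f' x))) (at x)"
    by (rule has_derivative_transform_within_open[OF _ \<open>open \<Omega>\<close> \<open>x \<in> \<Omega>\<close>]) (use inj in auto)
  then have "blinfun_apply (g' (f x)) \<circ> blinfun_apply (f' x) = (\<lambda>z. z)"
    using has_derivative_ident has_derivative_unique by blast
  moreover obtain v :: 'a where "v \<in> Basis" using nonempty_Basis by blast
  ultimately have "f' x \<noteq> 0"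
    by (metis comp_apply blinfun.zero_left blinfun.zero_right nonzero_Basis)
  then show ?thesis by simp
qed

text \<open>
  Conformality enters through \<open>norm (f' x (y - x)) = norm (f' x) * norm (y - x)\<close>: it makes the
  stretching quotient of a pair Hoelder-close to the scalar \<open>norm (f' x)\<close>, whatever the direction
  of the pair.
\<close>

lemma conformal_diffeo_distortion:
  fixes f :: "'a::euclidean_space \<Rightarrow> 'a"
  assumes diffeo: "C1_holder_diffeo_on \<epsilon> \<Omega> f f'"
    and conformal: "\<And>x y. x \<in> \<Omega> \<Longrightarrow> norm (blinfun_apply (f' x) y) = norm (f' x) * norm y"
    and lip: "c-lipschitz_on \<Omega> f"
    and "\<epsilon> > 0" "open \<Omega>" "compact F" "F \<subseteq> \<Omega>" "F \<noteq> {}"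
  shows "\<exists>H\<ge>0. \<forall>x\<in>F. \<forall>y\<in>F. \<forall>x'\<in>F. \<forall>y'\<in>F. \<forall>D.
     dist x y \<le> D \<longrightarrow> dist x' y' \<le> D \<longrightarrow> dist x x' \<le> D \<longrightarrow>
     dist (f x) (f y) * dist x' y' \<le> exp (H * D powr \<epsilon>) * (dist (f x') (f y') * dist x y)"
proof -
  have inj: "inj_on f \<Omega>"
    and f': "\<And>x. x \<in> \<Omega> \<Longrightarrow> (f has_derivative blinfun_apply (f' x)) (at x)"
    using diffeo unfolding C1_holder_diffeo_on_def by blast+
  obtain C where "C \<ge> 0" and C: "\<And>x y. x \<in> \<Omega> \<Longrightarrow> y \<in> \<Omega> \<Longrightarrow> dist (f' x) (f' y) \<le> C * dist x y powr \<epsilon>"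
    using diffeo unfolding C1_holder_diffeo_on_def holder_on_def by blast
  have c: "c \<ge> 0" "\<And>x y. x \<in> \<Omega> \<Longrightarrow> y \<in> \<Omega> \<Longrightarrow> dist (f x) (f y) \<le> c * dist x y"
    using lip by (auto simp: lipschitz_on_def)
  have contF: "continuous_on F f"
    using lipschitz_on_continuous_on[OF lip] \<open>F \<subseteq> \<Omega>\<close> continuous_on_subset by blast
  have "continuous_on \<Omega> f'"
  proof (unfold continuous_on_def, intro ballI)
    fix x assume "x \<in> \<Omega>"
    have "((\<lambda>y. C * dist y x powr \<epsilon>) \<longlongrightarrow> C * 0 powr \<epsilon>) (at x within \<Omega>)"
      using \<open>\<epsilon> > 0\<close> by (intro tendsto_mult tendsto_powr' tendsto_const tendsto_dist_iff[THEN iffD1] tendsto_ident_at) auto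
    then have "((\<lambda>y. C * dist y x powr \<epsilon>) \<longlongrightarrow> 0) (at x within \<Omega>)" using \<open>\<epsilon> > 0\<close> by simp
    moreover have "eventually (\<lambda>y. dist (f' y) (f' x) \<le> C * dist y x powr \<epsilon>) (at x within \<Omega>)"
      using C \<open>x \<in> \<Omega>\<close> by (auto simp: eventually_at_filter)
    ultimately show "(f' \<longlongrightarrow> f' x) (at x within \<Omega>)"
      by (subst tendsto_dist_iff) (rule tendsto_sandwich[OF _ _ tendsto_const], auto)
  qed
  then have contN: "continuous_on F (\<lambda>x. norm (f' x))"
    using \<open>F \<subseteq> \<Omega>\<close> continuous_on_norm continuous_on_subset by blast
  obtain xm where "xm \<in> F" and xm: "\<And>x. x \<in> F \<Longrightarrow> norm (f' xm) \<le> norm (f' x)"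
    using continuous_attains_inf[OF \<open>compact F\<close> \<open>F \<noteq> {}\<close> contN] by blast
  define g where "g = norm (f' xm)"
  have "g > 0" and g: "\<And>x. x \<in> F \<Longrightarrow> g \<le> norm (f' x)"
    using C1_holder_diffeo_derivative_nonzero[OF diffeo \<open>open \<Omega>\<close>] xm \<open>xm \<in> F\<close> \<open>F \<subseteq> \<Omega>\<close>
    by (auto simp: g_def)
  obtain xM where "xM \<in> F" and xM: "\<And>x. x \<in> F \<Longrightarrow> norm (f' x) \<le> norm (f' xM)"
    using continuous_attains_sup[OF \<open>compact F\<close> \<open>F \<noteq> {}\<close> contN] by blast
  \<comment> \<open>Pairs closer than \<open>\<eta>\<close> are joined inside a ball contained in
    \<open>\<Omega>\<close>, so the mean value inequality applies to them. Other pairs get only the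
    crude Lipschitz bound.\<close>
  obtain \<eta> where "\<eta> > 0" and \<eta>: "(\<Union>x\<in>F. cball x \<eta>) \<subseteq> \<Omega>"
    using compact_subset_open_imp_cball_epsilon_subset[OF \<open>compact F\<close> \<open>open \<Omega>\<close> \<open>F \<subseteq> \<Omega>\<close>] by blast
  have near: "norm (f y - f x - f' x (y - x)) \<le> C * dist x y powr \<epsilon> * dist x y"
    if "x \<in> F" "y \<in> F" "dist x y \<le> \<eta>" for x y
  proof -
    have sub: "cball x (dist x y) \<subseteq> \<Omega>" using \<eta> that by fastforce
    have "norm (f y - f x - f' x (y - x)) \<le> norm (y - x) * (C * dist x y powr \<epsilon>)"
    proof (rule differentiable_bound_linearization[where S = "cball x (dist x y)" and f' = "\<lambda>z. blinfun_apply (f' z)"])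
      fix t :: real assume "t \<in> {0..1}"
      then have "\<bar>t\<bar> * norm (y - x) \<le> 1 * norm (y - x)" by (intro mult_right_mono) auto
      then show "x + t *\<^sub>R (y - x) \<in> cball x (dist x y)"
        by (simp add: dist_norm norm_minus_commute)
    next
      fix z assume z: "z \<in> cball x (dist x y)"
      then show "(f has_derivative blinfun_apply (f' z)) (at z within cball x (dist x y))"
        using f' sub has_derivative_at_withinI by blast
      have "onorm (blinfun_apply (f' z - f' x)) \<le> C * dist z x powr \<epsilon>"
        using C[OF subsetD[OF sub z] subsetD[OF \<open>F \<subseteq> \<Omega>\<close> \<open>x \<in> F\<close>]]
        by (simp add: dist_norm norm_blinfun.rep_eq)
      also have "\<dots> \<le> C * dist x y powr \<epsilon>"
        using z \<open>C \<ge> 0\<close> \<open>\<epsilon> > 0\<close> by (intro mult_left_mono powr_mono2) (auto simp: dist_commute)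
      finally show "onorm (blinfun_apply (f' z) - blinfun_apply (f' x)) \<le> C * dist x y powr \<epsilon>"
        by (simp add: minus_blinfun.rep_eq fun_diff_def)
    qed auto
    then show ?thesis by (simp add: dist_norm norm_minus_commute mult.commute mult.left_commute)
  qed
  \<comment> \<open>The second summand absorbs the crude bound: beyond distance
    \<open>\<eta>\<close> the factor \<open>dist x y powr \<epsilon>\<close> is at least
    \<open>\<eta> powr \<epsilon>\<close>.\<close>
  define E where "E = C + (c + norm (f' xM)) / \<eta> powr \<epsilon>"
  have "E \<ge> 0" using \<open>C \<ge> 0\<close> c(1) by (simp add: E_def)
  have linear: "norm (f y - f x - f' x (y - x)) \<le> E * dist x y powr \<epsilon> * dist x y"
    if "x \<in> F" "y \<in> F" for x y
  proof (cases "dist x y \<le> \<eta>")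
    case True
    have "C * dist x y powr \<epsilon> * dist x y \<le> E * dist x y powr \<epsilon> * dist x y"
      using c(1) by (intro mult_right_mono) (auto simp: E_def)
    then show ?thesis using near[OF that True] by linarith
  next
    case False
    have "norm (f y - f x - f' x (y - x)) \<le> norm (f y - f x) + norm (f' x (y - x))"
      by (rule norm_triangle_ineq4)
    also have "\<dots> \<le> c * dist x y + norm (f' xM) * dist x y"
      using c(2)[of y x] xM[OF \<open>x \<in> F\<close>] conformal[of x] that \<open>F \<subseteq> \<Omega>\<close>
      by (intro add_mono) (auto simp: dist_norm norm_minus_commute mult_right_mono)
    also have "\<dots> = ((c + norm (f' xM)) / \<eta> powr \<epsilon>) * \<eta> powr \<epsilon> * dist x y"
      using \<open>\<eta> > 0\<close> by (simp add: field_simps)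
    also have "\<dots> \<le> E * dist x y powr \<epsilon> * dist x y"
      using False \<open>\<eta> > 0\<close> \<open>\<epsilon> > 0\<close> c(1) \<open>C \<ge> 0\<close>
      by (intro mult_right_mono mult_mono powr_mono2) (auto simp: E_def)
    finally show ?thesis .
  qed
  have upper: "dist (f x) (f y) \<le> norm (f' x) * dist x y + E * dist x y powr \<epsilon> * dist x y"
    and lower: "norm (f' x) * dist x y \<le> dist (f x) (f y) + E * dist x y powr \<epsilon> * dist x y"
    if "x \<in> F" "y \<in> F" for x y
  proof -
    have "norm (f' x (y - x)) = norm (f' x) * dist x y"
      using conformal that \<open>F \<subseteq> \<Omega>\<close> by (auto simp: dist_norm norm_minus_commute)
    then show "dist (f x) (f y) \<le> norm (f' x) * dist x y + E * dist x y powr \<epsilon> * dist x y"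
      "norm (f' x) * dist x y \<le> dist (f x) (f y) + E * dist x y powr \<epsilon> * dist x y"
      using linear[OF that] norm_triangle_ineq2[of "f y - f x" "f' x (y - x)"]
        norm_triangle_ineq3[of "f y - f x" "f' x (y - x)"]
      by (auto simp: dist_norm norm_minus_commute)
  qed
  \<comment> \<open>The distance below which the linearization error is at most half of the smallest
    derivative \<open>g\<close>; \<open>E + 1\<close> avoids division by zero.\<close>
  define \<eta>2 where "\<eta>2 = (g / (2 * (E + 1))) powr (1 / \<epsilon>)"
  have "\<eta>2 > 0" using \<open>g > 0\<close> \<open>E \<ge> 0\<close> by (simp add: \<eta>2_def)
  have \<eta>2: "E * t powr \<epsilon> \<le> g / 2" if "0 \<le> t" "t \<le> \<eta>2" for t
  proof -
    have "t powr \<epsilon> \<le> \<eta>2 powr \<epsilon>" using that \<open>\<epsilon> > 0\<close> by (intro powr_mono2) auto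
    also have "\<dots> = g / (2 * (E + 1))"
      using \<open>g > 0\<close> \<open>E \<ge> 0\<close> \<open>\<epsilon> > 0\<close> by (simp add: \<eta>2_def powr_powr)
    finally have "E * t powr \<epsilon> \<le> E * (g / (2 * (E + 1)))" using \<open>E \<ge> 0\<close> by (rule mult_left_mono)
    also have "\<dots> \<le> g / 2" using \<open>g > 0\<close> \<open>E \<ge> 0\<close> by (simp add: field_simps)
    finally show ?thesis .
  qed
  \<comment> \<open>Short pairs are handled by linearization. Pairs at distance at least
    \<open>\<eta>2\<close> form a compact set, on which injectivity keeps the image distance away
    from zero.\<close>
  have "\<exists>m>0. \<forall>x\<in>F. \<forall>y\<in>F. m * dist x y \<le> dist (f x) (f y)"
  proof -
    define P where "P = {p \<in> F \<times> F. dist (fst p) (snd p) \<ge> \<eta>2}"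
    have "P = (F \<times> F) \<inter> {p. \<eta>2 \<le> dist (fst p) (snd p)}" by (auto simp: P_def)
    then have "compact P"
      by (auto intro!: compact_Int_closed compact_Times \<open>compact F\<close> closed_Collect_le continuous_intros)
    have contP: "continuous_on P (\<lambda>p. dist (f (fst p)) (f (snd p)))"
      by (intro continuous_on_dist continuous_on_compose2[OF contF] continuous_intros) (auto simp: P_def)
    obtain \<delta> where "\<delta> > 0" and \<delta>: "\<And>x y. x \<in> F \<Longrightarrow> y \<in> F \<Longrightarrow> \<eta>2 \<le> dist x y \<Longrightarrow> \<delta> \<le> dist (f x) (f y)"
    proof (cases "P = {}")
      case True
      then show ?thesis using that[of 1] by (auto simp: P_def)
    next
      case False
      obtain p where "p \<in> P" "\<And>q. q \<in> P \<Longrightarrow> dist (f (fst p)) (f (snd p)) \<le> dist (f (fst q)) (f (snd q))"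
        using continuous_attains_inf[OF \<open>compact P\<close> False contP] by blast
      moreover have "f (fst p) \<noteq> f (snd p)"
        using \<open>p \<in> P\<close> \<open>\<eta>2 > 0\<close>
        by (auto simp: P_def dest!: inj_onD[OF inj_on_subset[OF inj \<open>F \<subseteq> \<Omega>\<close>]])
      ultimately show ?thesis using that[of "dist (f (fst p)) (f (snd p))"] by (fastforce simp: P_def)
    qed
    define \<Delta> where "\<Delta> = diameter F + 1"
    have "bounded F" by (rule compact_imp_bounded[OF \<open>compact F\<close>])
    have "\<Delta> > 0" using diameter_ge_0[OF \<open>bounded F\<close>] by (simp add: \<Delta>_def)
    have "min (g / 2) (\<delta> / \<Delta>) * dist x y \<le> dist (f x) (f y)" if "x \<in> F" "y \<in> F" for x y
    proof (cases "dist x y \<le> \<eta>2")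
      case True
      have "E * dist x y powr \<epsilon> * dist x y \<le> g / 2 * dist x y"
        using \<eta>2[OF _ True] by (intro mult_right_mono) auto
      moreover have "g * dist x y \<le> norm (f' x) * dist x y" using g that by (intro mult_right_mono) auto
      ultimately have "g / 2 * dist x y \<le> dist (f x) (f y)" using lower[OF that] by simp
      moreover have "min (g / 2) (\<delta> / \<Delta>) * dist x y \<le> g / 2 * dist x y"
        by (rule mult_right_mono[OF min.cobounded1]) auto
      ultimately show ?thesis by linarith
    next
      case False
      have "dist x y \<le> \<Delta>" using diameter_bounded_bound[OF \<open>bounded F\<close>] that by (fastforce simp: \<Delta>_def)
      then have "min (g / 2) (\<delta> / \<Delta>) * dist x y \<le> \<delta> / \<Delta> * \<Delta>"
        using \<open>g > 0\<close> \<open>\<delta> > 0\<close> \<open>\<Delta> > 0\<close> by (intro mult_mono) auto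
      also have "\<dots> = \<delta>" using \<open>\<Delta> > 0\<close> by simp
      also have "\<dots> \<le> dist (f x) (f y)" using \<delta> that False by auto
      finally show ?thesis .
    qed
    then show ?thesis using \<open>g > 0\<close> \<open>\<delta> > 0\<close> \<open>\<Delta> > 0\<close>
      by (intro exI[of _ "min (g / 2) (\<delta> / \<Delta>)"]) auto
  qed
  then obtain m where "m > 0" and m: "\<And>x y. x \<in> F \<Longrightarrow> y \<in> F \<Longrightarrow> m * dist x y \<le> dist (f x) (f y)"
    by blast
  \<comment> \<open>One summand per relative error: linearizing at \<open>x\<close>, moving the
    derivative from \<open>x\<close> to \<open>x'\<close>, and linearizing at \<open>x'\<close>. The
    last error is measured against \<open>dist (f x') (f y')\<close>, hence \<open>m\<close> in
    place of \<open>g\<close>. Each factor \<open>1 + t\<close> is bounded by \<open>exp t\<close>,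
    so that errors of successive letters add up in the exponent.\<close>
  define H where "H = E / g + C / g + E / m"
  have "H \<ge> 0" using \<open>E \<ge> 0\<close> \<open>C \<ge> 0\<close> \<open>g > 0\<close> \<open>m > 0\<close> by (simp add: H_def)
  moreover have "dist (f x) (f y) * dist x' y' \<le> exp (H * D powr \<epsilon>) * (dist (f x') (f y') * dist x y)"
    if "x \<in> F" "y \<in> F" "x' \<in> F" "y' \<in> F" and D: "dist x y \<le> D" "dist x' y' \<le> D" "dist x x' \<le> D"
    for x y x' y' D
  proof -
    define p where "p = D powr \<epsilon>"
    have p: "dist x y powr \<epsilon> \<le> p" "dist x' y' powr \<epsilon> \<le> p" "dist x x' powr \<epsilon> \<le> p" "p \<ge> 0"
      using D \<open>\<epsilon> > 0\<close> by (auto simp: p_def intro!: powr_mono2)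
    have "dist (f x) (f y) \<le> norm (f' x) * dist x y + E * dist x y powr \<epsilon> * dist x y"
      by (rule upper) fact+
    also have "\<dots> \<le> norm (f' x) * dist x y + E / g * p * norm (f' x) * dist x y"
    proof -
      have "E * dist x y powr \<epsilon> \<le> E * p" using p \<open>E \<ge> 0\<close> by (intro mult_left_mono) auto
      also have "\<dots> = E / g * p * g" using \<open>g > 0\<close> by simp
      also have "\<dots> \<le> E / g * p * norm (f' x)"
        using g[OF \<open>x \<in> F\<close>] \<open>E \<ge> 0\<close> \<open>g > 0\<close> p by (intro mult_left_mono) auto
      finally show ?thesis by (intro add_left_mono mult_right_mono) auto
    qed
    also have "\<dots> = (1 + E / g * p) * (norm (f' x) * dist x y)" by (simp add: algebra_simps)
    also have "\<dots> \<le> exp (E / g * p) * (norm (f' x) * dist x y)"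
      by (intro mult_right_mono exp_ge_add_one_self) auto
    finally have 1: "dist (f x) (f y) \<le> exp (E / g * p) * (norm (f' x) * dist x y)" .
    have "norm (f' x) \<le> norm (f' x') + dist (f' x) (f' x')"
      using norm_triangle_sub[of "f' x" "f' x'"] by (simp add: dist_norm)
    also have "dist (f' x) (f' x') \<le> C * p"
      using C[of x x'] p that \<open>F \<subseteq> \<Omega>\<close> mult_left_mono[OF p(3) \<open>C \<ge> 0\<close>] by (meson order_trans subsetD)
    also have "C * p = C / g * p * g" using \<open>g > 0\<close> by simp
    also have "\<dots> \<le> C / g * p * norm (f' x')"
      using g[OF \<open>x' \<in> F\<close>] \<open>C \<ge> 0\<close> \<open>g > 0\<close> p by (intro mult_left_mono) auto
    also have "norm (f' x') + \<dots> = (1 + C / g * p) * norm (f' x')" by (simp add: algebra_simps)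
    also have "\<dots> \<le> exp (C / g * p) * norm (f' x')" by (intro mult_right_mono exp_ge_add_one_self) auto
    finally have 2: "norm (f' x) \<le> exp (C / g * p) * norm (f' x')" by simp
    have "norm (f' x') * dist x' y' \<le> dist (f x') (f y') + E * dist x' y' powr \<epsilon> * dist x' y'"
      by (rule lower) fact+
    also have "\<dots> \<le> dist (f x') (f y') + E * p * (dist (f x') (f y') / m)"
      using p m[OF \<open>x' \<in> F\<close> \<open>y' \<in> F\<close>] \<open>m > 0\<close> \<open>E \<ge> 0\<close>
      by (intro add_left_mono mult_mono mult_left_mono) (auto simp: field_simps)
    also have "\<dots> = (1 + E / m * p) * dist (f x') (f y')" by (simp add: algebra_simps)
    also have "\<dots> \<le> exp (E / m * p) * dist (f x') (f y')" by (intro mult_right_mono exp_ge_add_one_self) auto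
    finally have 3: "norm (f' x') * dist x' y' \<le> exp (E / m * p) * dist (f x') (f y')" .
    have "dist (f x) (f y) * dist x' y' \<le> exp (E / g * p) * (norm (f' x) * dist x y) * dist x' y'"
      by (intro mult_right_mono 1) auto
    also have "\<dots> \<le> exp (E / g * p) * (exp (C / g * p) * norm (f' x') * dist x y) * dist x' y'"
      by (intro mult_right_mono mult_left_mono 2) auto
    also have "\<dots> = exp (E / g * p) * exp (C / g * p) * dist x y * (norm (f' x') * dist x' y')" by simp
    also have "\<dots> \<le> exp (E / g * p) * exp (C / g * p) * dist x y * (exp (E / m * p) * dist (f x') (f y'))"
      by (intro mult_left_mono 3) auto
    also have "\<dots> = exp (H * p) * (dist (f x') (f y') * dist x y)"
      by (simp add: H_def distrib_right exp_add)
    finally show ?thesis by (simp add: p_def)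
  qed
  ultimately show ?thesis by blast
qed

section \<open>Compositions along words: contraction and bounded distortion\<close>

lemma word_map_Nil [simp]: "word_map \<phi> [] = id"
  by (simp add: word_map_def)

lemma word_map_Cons [simp]: "word_map \<phi> (i # w) = \<phi> i \<circ> word_map \<phi> w"
  by (simp add: word_map_def)

lemma word_map_append [simp]: "word_map \<phi> (u @ v) = word_map \<phi> u \<circ> word_map \<phi> v"
  by (induction u) auto

locale separated_ifs =
  fixes \<Lambda> :: "'i set" and \<phi> :: "'i \<Rightarrow> 'a::euclidean_space \<Rightarrow> 'a" and F :: "'a set" and c :: real
  assumes finite_alphabet: "finite \<Lambda>"
    and F_nonempty: "F \<noteq> {}"
    and compact_F: "compact F"
    and F_eq: "F = (\<Union>i\<in>\<Lambda>. \<phi> i ` F)"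
    and c_pos: "0 < c" and c_less_1: "c < 1"
    and contraction: "\<And>i x y. i \<in> \<Lambda> \<Longrightarrow> x \<in> F \<Longrightarrow> y \<in> F \<Longrightarrow> dist (\<phi> i x) (\<phi> i y) \<le> c * dist x y"
    and inj: "\<And>i. i \<in> \<Lambda> \<Longrightarrow> inj_on (\<phi> i) F"
    and separation: "strong_separation \<Lambda> \<phi> F"
begin

lemma bounded_F: "bounded F"
  by (rule compact_imp_bounded[OF compact_F])

lemma map_in_F: "i \<in> \<Lambda> \<Longrightarrow> x \<in> F \<Longrightarrow> \<phi> i x \<in> F"
  using F_eq by blast

lemma word_map_in_F: "w \<in> lists \<Lambda> \<Longrightarrow> x \<in> F \<Longrightarrow> word_map \<phi> w x \<in> F"
  by (induction w) (auto intro: map_in_F)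

lemma word_map_contraction:
  "w \<in> lists \<Lambda> \<Longrightarrow> x \<in> F \<Longrightarrow> y \<in> F \<Longrightarrow> dist (word_map \<phi> w x) (word_map \<phi> w y) \<le> c ^ length w * dist x y"
proof (induction w)
  case (Cons i w)
  have "dist (word_map \<phi> (i # w) x) (word_map \<phi> (i # w) y) \<le> c * dist (word_map \<phi> w x) (word_map \<phi> w y)"
    using Cons.prems by (auto intro!: contraction word_map_in_F)
  also have "\<dots> \<le> c * (c ^ length w * dist x y)"
    using Cons c_pos by (intro mult_left_mono) auto
  finally show ?case by simp
qed simp

lemma inj_word_map: "w \<in> lists \<Lambda> \<Longrightarrow> inj_on (word_map \<phi> w) F"
proof (induction w)
  case (Cons i w)
  have "word_map \<phi> w ` F \<subseteq> F" using Cons.prems word_map_in_F by auto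
  moreover have "inj_on (word_map \<phi> w) F" "inj_on (\<phi> i) F" using Cons inj by auto
  ultimately show ?case unfolding word_map_Cons by (intro comp_inj_on) (auto intro: inj_on_subset)
qed simp

end

text \<open>
  The images of a set under the tails of \<open>w\<close> shrink geometrically, so the logarithms of the
  letterwise distortions are dominated by a geometric series.
\<close>

lemma (in separated_ifs) word_map_distortion:
  assumes "\<epsilon> > 0" and "H \<ge> 0"
    and H: "\<And>i x y x' y' D. i \<in> \<Lambda> \<Longrightarrow> x \<in> F \<Longrightarrow> y \<in> F \<Longrightarrow> x' \<in> F \<Longrightarrow> y' \<in> F \<Longrightarrow>
       dist x y \<le> D \<Longrightarrow> dist x' y' \<le> D \<Longrightarrow> dist x x' \<le> D \<Longrightarrow>
       dist (\<phi> i x) (\<phi> i y) * dist x' y' \<le> exp (H * D powr \<epsilon>) * (dist (\<phi> i x') (\<phi> i y') * dist x y)"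
  shows "\<exists>K>0. \<forall>w\<in>lists \<Lambda>. \<forall>x\<in>F. \<forall>y\<in>F. \<forall>x'\<in>F. \<forall>y'\<in>F.
     dist (word_map \<phi> w x) (word_map \<phi> w y) * dist x' y'
       \<le> K * (dist (word_map \<phi> w x') (word_map \<phi> w y') * dist x y)"
proof -
  define \<Delta> where "\<Delta> = diameter F"
  have \<Delta>: "\<Delta> \<ge> 0" "\<And>x y. x \<in> F \<Longrightarrow> y \<in> F \<Longrightarrow> dist x y \<le> \<Delta>"
    using diameter_ge_0[OF bounded_F] diameter_bounded_bound[OF bounded_F] by (auto simp: \<Delta>_def)
  define q where "q = c powr \<epsilon>"
  have q: "0 < q" "q < 1" using c_pos c_less_1 \<open>\<epsilon> > 0\<close> powr_less_mono2[of \<epsilon> c 1] by (auto simp: q_def)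
  define S where "S n = (\<Sum>k<n. H * (\<Delta> powr \<epsilon> * q ^ k))" for n
  have *: "dist (word_map \<phi> w x) (word_map \<phi> w y) * dist x' y'
      \<le> exp (S (length w)) * (dist (word_map \<phi> w x') (word_map \<phi> w y') * dist x y)"
    if "w \<in> lists \<Lambda>" "x \<in> F" "y \<in> F" "x' \<in> F" "y' \<in> F" for w x y x' y'
    using that(1)
  proof (induction w)
    case Nil
    then show ?case by (simp add: S_def)
  next
    case (Cons i w)
    then have "i \<in> \<Lambda>" "w \<in> lists \<Lambda>" by auto
    let ?g = "word_map \<phi> w"
    define d where "d = c ^ length w * \<Delta>"
    have in_F: "?g x \<in> F" "?g y \<in> F" "?g x' \<in> F" "?g y' \<in> F"
      using \<open>w \<in> lists \<Lambda>\<close> that word_map_in_F by auto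
    have close: "dist (?g a) (?g b) \<le> d" if "a \<in> F" "b \<in> F" for a b
      using word_map_contraction[OF \<open>w \<in> lists \<Lambda>\<close> that] \<Delta>(2)[OF that] c_pos
      by (auto simp: d_def intro: order_trans mult_left_mono)
    have "d powr \<epsilon> = \<Delta> powr \<epsilon> * q ^ length w"
      using c_pos \<Delta>(1) by (simp add: d_def q_def powr_mult powr_powr powr_realpow[symmetric] mult.commute)
    then have S: "exp (S (length (i # w))) = exp (S (length w)) * exp (H * d powr \<epsilon>)"
      by (simp add: S_def exp_add)
    let ?A = "dist (\<phi> i (?g x)) (\<phi> i (?g y))" and ?B = "dist (\<phi> i (?g x')) (\<phi> i (?g y'))"
    have step: "?A * dist (?g x') (?g y') \<le> exp (H * d powr \<epsilon>) * (?B * dist (?g x) (?g y))"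
      by (intro H \<open>i \<in> \<Lambda>\<close> in_F close that)
    have IH: "dist (?g x) (?g y) * dist x' y' \<le> exp (S (length w)) * (dist (?g x') (?g y') * dist x y)"
      using Cons.IH \<open>w \<in> lists \<Lambda>\<close> by blast
    \<comment> \<open>The intermediate factor \<open>dist (?g x') (?g y')\<close> is to be
      cancelled. Injectivity makes it positive unless \<open>x' = y'\<close>, and then both sides
      vanish.\<close>
    show ?case
    proof (cases "x' = y'")
      case True
      then show ?thesis by simp
    next
      case False
      then have pos: "dist (?g x') (?g y') > 0"
        using inj_onD[OF inj_word_map[OF \<open>w \<in> lists \<Lambda>\<close>]] that by auto
      have "(?A * dist x' y') * dist (?g x') (?g y') = (?A * dist (?g x') (?g y')) * dist x' y'" by simp
      also have "\<dots> \<le> (exp (H * d powr \<epsilon>) * (?B * dist (?g x) (?g y))) * dist x' y'"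
        by (intro mult_right_mono step) auto
      also have "\<dots> = exp (H * d powr \<epsilon>) * ?B * (dist (?g x) (?g y) * dist x' y')" by simp
      also have "\<dots> \<le> exp (H * d powr \<epsilon>) * ?B * (exp (S (length w)) * (dist (?g x') (?g y') * dist x y))"
        by (intro mult_left_mono IH) auto
      also have "\<dots> = (exp (S (length (i # w))) * (?B * dist x y)) * dist (?g x') (?g y')"
        by (simp only: S mult_ac)
      finally show ?thesis using pos by (simp add: mult_le_cancel_right)
    qed
  qed
  define K where "K = exp (H * \<Delta> powr \<epsilon> / (1 - q))"
  have "S n \<le> H * \<Delta> powr \<epsilon> / (1 - q)" for n
  proof -
    have "S n = H * \<Delta> powr \<epsilon> * (\<Sum>k<n. q ^ k)" by (simp add: S_def sum_distrib_left mult.assoc)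
    also have "(\<Sum>k<n. q ^ k) = (1 - q ^ n) / (1 - q)" using q by (simp add: sum_gp_strict)
    also have "\<dots> \<le> 1 / (1 - q)" using q by (intro divide_right_mono) auto
    finally show ?thesis using \<open>H \<ge> 0\<close> by (simp add: mult_left_mono)
  qed
  then have "exp (S n) \<le> K" for n by (simp add: K_def)
  then have "dist (word_map \<phi> w x) (word_map \<phi> w y) * dist x' y'
      \<le> K * (dist (word_map \<phi> w x') (word_map \<phi> w y') * dist x y)"
    if "w \<in> lists \<Lambda>" "x \<in> F" "y \<in> F" "x' \<in> F" "y' \<in> F" for w x y x' y'
    using *[OF that] by (meson mult_right_mono order_trans mult_nonneg_nonneg zero_le_dist)
  then show ?thesis by (intro exI[of _ K]) (auto simp: K_def)
qed

text \<open>The passage from smooth to metric data: afterwards only distances between points of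
  \<open>F\<close> occur, and neither \<open>\<Omega>\<close> nor a derivative is mentioned.\<close>

lemma self_conformal_ifs_separated_distortion:
  assumes ifs: "self_conformal_ifs \<Lambda> \<phi> \<Omega> X0" and limit: "is_limit_set \<Lambda> \<phi> \<Omega> F"
    and ssc: "strong_separation \<Lambda> \<phi> F"
  obtains c K where "separated_ifs \<Lambda> \<phi> F c" "K > 0"
    "\<And>w x y x' y'. w \<in> lists \<Lambda> \<Longrightarrow> x \<in> F \<Longrightarrow> y \<in> F \<Longrightarrow> x' \<in> F \<Longrightarrow> y' \<in> F \<Longrightarrow>
     dist (word_map \<phi> w x) (word_map \<phi> w y) * dist x' y'
       \<le> K * (dist (word_map \<phi> w x') (word_map \<phi> w y') * dist x y)"
proof -
  have "finite \<Lambda>" "open \<Omega>" using ifs by (auto simp: self_conformal_ifs_def)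
  have F: "F \<subseteq> \<Omega>" "F \<noteq> {}" "compact F" "F = (\<Union>i\<in>\<Lambda>. \<phi> i ` F)"
    using limit by (auto simp: is_limit_set_def)
  obtain \<epsilon> where "\<epsilon> > 0" and \<epsilon>: "\<And>i. i \<in> \<Lambda> \<Longrightarrow> (\<exists>c<1. c-lipschitz_on \<Omega> (\<phi> i)) \<and>
        (\<exists>f'. C1_holder_diffeo_on \<epsilon> \<Omega> (\<phi> i) f' \<and>
              (\<forall>x\<in>\<Omega>. \<forall>y. norm (blinfun_apply (f' x) y) = norm (f' x) * norm y))"
    using ifs unfolding self_conformal_ifs_def by blast
  obtain r where r: "\<And>i. i \<in> \<Lambda> \<Longrightarrow> r i < 1 \<and> (r i)-lipschitz_on \<Omega> (\<phi> i)" using \<epsilon> by metis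
  obtain f' where f': "\<And>i. i \<in> \<Lambda> \<Longrightarrow> C1_holder_diffeo_on \<epsilon> \<Omega> (\<phi> i) (f' i) \<and>
      (\<forall>x\<in>\<Omega>. \<forall>y. norm (blinfun_apply (f' i x) y) = norm (f' i x) * norm y)"
    using \<epsilon> by metis
  \<comment> \<open>Including \<open>1/2\<close> makes \<open>c\<close> positive outright, as its
    real powers and its logarithm are taken later.\<close>
  define c where "c = Max (insert (1/2) (r ` \<Lambda>))"
  have c: "0 < c" "c < 1" "\<And>i. i \<in> \<Lambda> \<Longrightarrow> r i \<le> c"
    using \<open>finite \<Lambda>\<close> r by (auto simp: c_def Max_gr_iff)
  have "dist (\<phi> i x) (\<phi> i y) \<le> c * dist x y" if "i \<in> \<Lambda>" "x \<in> F" "y \<in> F" for i x y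
  proof -
    have "dist (\<phi> i x) (\<phi> i y) \<le> r i * dist x y"
      using r[OF \<open>i \<in> \<Lambda>\<close>] that F(1) by (auto simp: lipschitz_on_def)
    also have "\<dots> \<le> c * dist x y" using c(3)[OF \<open>i \<in> \<Lambda>\<close>] by (intro mult_right_mono) auto
    finally show ?thesis .
  qed
  moreover have "inj_on (\<phi> i) F" if "i \<in> \<Lambda>" for i
    using f'[OF that] F(1) by (auto simp: C1_holder_diffeo_on_def intro: inj_on_subset)
  ultimately have sep: "separated_ifs \<Lambda> \<phi> F c"
    using \<open>finite \<Lambda>\<close> F c ssc by unfold_locales auto
  have "\<exists>H\<ge>0. \<forall>x\<in>F. \<forall>y\<in>F. \<forall>x'\<in>F. \<forall>y'\<in>F. \<forall>D.
     dist x y \<le> D \<longrightarrow> dist x' y' \<le> D \<longrightarrow> dist x x' \<le> D \<longrightarrow>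
     dist (\<phi> i x) (\<phi> i y) * dist x' y' \<le> exp (H * D powr \<epsilon>) * (dist (\<phi> i x') (\<phi> i y') * dist x y)"
    if "i \<in> \<Lambda>" for i
    using f'[OF that] r[OF that] \<open>\<epsilon> > 0\<close> \<open>open \<Omega>\<close> F
    by (intro conformal_diffeo_distortion[where f' = "f' i" and c = "r i" and \<Omega> = \<Omega>]) auto
  then obtain h where h: "\<And>i. i \<in> \<Lambda> \<Longrightarrow> h i \<ge> 0"
    "\<And>i x y x' y' D. i \<in> \<Lambda> \<Longrightarrow> x \<in> F \<Longrightarrow> y \<in> F \<Longrightarrow> x' \<in> F \<Longrightarrow> y' \<in> F \<Longrightarrow>
     dist x y \<le> D \<Longrightarrow> dist x' y' \<le> D \<Longrightarrow> dist x x' \<le> D \<Longrightarrow>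
     dist (\<phi> i x) (\<phi> i y) * dist x' y' \<le> exp (h i * D powr \<epsilon>) * (dist (\<phi> i x') (\<phi> i y') * dist x y)"
    by metis
  define H where "H = sum h \<Lambda>"
  have "H \<ge> 0" using h(1) by (auto simp: H_def intro: sum_nonneg)
  moreover have "dist (\<phi> i x) (\<phi> i y) * dist x' y' \<le> exp (H * D powr \<epsilon>) * (dist (\<phi> i x') (\<phi> i y') * dist x y)"
    if "i \<in> \<Lambda>" "x \<in> F" "y \<in> F" "x' \<in> F" "y' \<in> F" "dist x y \<le> D" "dist x' y' \<le> D" "dist x x' \<le> D"
    for i x y x' y' D
  proof -
    have "h i \<le> H" unfolding H_def using \<open>finite \<Lambda>\<close> h(1) \<open>i \<in> \<Lambda>\<close> by (intro member_le_sum) auto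
    then have "exp (h i * D powr \<epsilon>) \<le> exp (H * D powr \<epsilon>)" by (simp add: mult_right_mono)
    then show ?thesis using h(2)[OF that] by (meson mult_right_mono order_trans mult_nonneg_nonneg zero_le_dist)
  qed
  ultimately show ?thesis
    using separated_ifs.word_map_distortion[OF sep \<open>\<epsilon> > 0\<close>, of H] that[OF sep] by metis
qed

section \<open>Pieces of the limit set and the coding map\<close>

context separated_ifs
begin

definition piece :: "'i list \<Rightarrow> 'a set" where
  "piece w = word_map \<phi> w ` F"

lemma piece_Nil [simp]: "piece [] = F"
  by (simp add: piece_def)

lemma piece_Cons: "piece (i # w) = \<phi> i ` piece w"
  by (simp add: piece_def image_comp)

lemma piece_subset: "w \<in> lists \<Lambda> \<Longrightarrow> piece w \<subseteq> F"
  using word_map_in_F by (auto simp: piece_def)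

lemma piece_nonempty: "piece w \<noteq> {}"
  using F_nonempty by (simp add: piece_def)

lemma piece_append_subset:
  assumes "v \<in> lists \<Lambda>"
  shows "piece (u @ v) \<subseteq> piece u"
proof -
  have "piece (u @ v) = word_map \<phi> u ` piece v" by (simp add: piece_def image_comp)
  then show ?thesis using piece_subset[OF assms] by (auto simp: piece_def)
qed

lemma compact_piece:
  assumes "w \<in> lists \<Lambda>"
  shows "compact (piece w)"
proof -
  have "(c ^ length w)-lipschitz_on F (word_map \<phi> w)"
    using word_map_contraction[OF assms] c_pos by (auto simp: lipschitz_on_def)
  then show ?thesis unfolding piece_def
    by (intro compact_continuous_image lipschitz_on_continuous_on compact_F)
qed

lemma diameter_piece_le:
  assumes "w \<in> lists \<Lambda>" "x \<in> piece w" "y \<in> piece w"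
  shows "dist x y \<le> c ^ length w * diameter F"
proof -
  obtain a b where ab: "a \<in> F" "b \<in> F" "x = word_map \<phi> w a" "y = word_map \<phi> w b"
    using assms by (auto simp: piece_def)
  have "dist a b \<le> diameter F" using diameter_bounded_bound[OF bounded_F] ab by auto
  then have "c ^ length w * dist a b \<le> c ^ length w * diameter F"
    using c_pos by (intro mult_left_mono) auto
  then show ?thesis using word_map_contraction[OF assms(1) ab(1,2)] ab by simp
qed

text \<open>Strong separation acts at the first letter where the words differ; injectivity carries
  the disjointness through their common prefix.\<close>

lemma piece_disjoint:
  assumes "length u = length v" "u \<in> lists \<Lambda>" "v \<in> lists \<Lambda>" "u \<noteq> v"
  shows "piece u \<inter> piece v = {}"
  using assms
proof (induction u v rule: list_induct2)
  case (Cons i u j v)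
  then have ij: "i \<in> \<Lambda>" "j \<in> \<Lambda>" "u \<in> lists \<Lambda>" "v \<in> lists \<Lambda>" by auto
  have sub: "piece u \<subseteq> F" "piece v \<subseteq> F" using ij piece_subset by auto
  show ?case
  proof (cases "i = j")
    case True
    then have "\<phi> i ` piece u \<inter> \<phi> i ` piece v = \<phi> i ` (piece u \<inter> piece v)"
      using inj_on_image_Int[OF inj[OF ij(1)] sub] by simp
    then show ?thesis using Cons True ij by (auto simp: piece_Cons)
  next
    case False
    then have "\<phi> i ` F \<inter> \<phi> j ` F = {}" using separation ij by (simp add: strong_separation_def)
    then show ?thesis using sub by (auto simp: piece_Cons)
  qed
qed simp

lemma in_some_piece: "y \<in> F \<Longrightarrow> \<exists>w\<in>lists \<Lambda>. length w = n \<and> y \<in> piece w"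
proof (induction n arbitrary: y)
  case 0
  then show ?case by (intro bexI[of _ "[]"]) auto
next
  case (Suc n)
  then obtain i x where i: "i \<in> \<Lambda>" "x \<in> F" "y = \<phi> i x" using F_eq by blast
  then obtain w where "w \<in> lists \<Lambda>" "length w = n" "x \<in> piece w" using Suc.IH by blast
  with i show ?case by (intro bexI[of _ "i # w"]) (auto simp: piece_Cons)
qed

lemma piece_eq_Union:
  assumes "u \<in> lists \<Lambda>"
  shows "piece u = (\<Union>w\<in>{w \<in> lists \<Lambda>. length w = n}. piece (u @ w))"
proof
  show "piece u \<subseteq> (\<Union>w\<in>{w \<in> lists \<Lambda>. length w = n}. piece (u @ w))"
  proof
    fix x assume "x \<in> piece u"
    then obtain y where y: "y \<in> F" "x = word_map \<phi> u y" by (auto simp: piece_def)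
    then obtain w where "w \<in> lists \<Lambda>" "length w = n" "y \<in> piece w" using in_some_piece by blast
    with y show "x \<in> (\<Union>w\<in>{w \<in> lists \<Lambda>. length w = n}. piece (u @ w))"
      by (auto simp: piece_def)
  qed
qed (use piece_append_subset in blast)

lemma finite_words: "finite {w \<in> lists \<Lambda>. length w = n}"
  using finite_lists_length_eq[OF finite_alphabet, of n] by (simp add: lists_eq_set conj_commute)

lemma length_word_prefix [simp]: "length (word_prefix \<omega> n) = n"
  by (simp add: word_prefix_def)

lemma word_prefix_in_lists: "range \<omega> \<subseteq> \<Lambda> \<Longrightarrow> word_prefix \<omega> n \<in> lists \<Lambda>"
  by (fastforce simp: word_prefix_def)

text \<open>\<open>the_elem\<close> is meaningful only on a singleton: nested compact pieces have a
  common point, and their diameters tend to zero.\<close>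

lemma coding_map_in_piece:
  assumes \<omega>: "range \<omega> \<subseteq> \<Lambda>"
  shows "coding_map \<phi> F \<omega> \<in> piece (word_prefix \<omega> n)"
proof -
  let ?P = "\<lambda>n. piece (word_prefix \<omega> n)"
  have lists: "word_prefix \<omega> n \<in> lists \<Lambda>" for n using word_prefix_in_lists[OF \<omega>] .
  have mono: "?P n \<subseteq> ?P m" if "m \<le> n" for m n
  proof -
    have "word_prefix \<omega> n = word_prefix \<omega> m @ map \<omega> [m..<n]"
      using that upt_add_eq_append[of 0 m "n - m"] by (simp add: word_prefix_def flip: map_append)
    moreover have "map \<omega> [m..<n] \<in> lists \<Lambda>" using \<omega> by fastforce
    ultimately show ?thesis using piece_append_subset by metis
  qed
  have "\<Inter>(range ?P) \<noteq> {}"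
    by (intro compact_nest compact_piece lists piece_nonempty mono)
  then obtain z where z: "\<And>n. z \<in> ?P n" by auto
  have eq: "(\<Inter>n\<in>{1..}. word_map \<phi> (word_prefix \<omega> n) ` F) = {z}"
  proof (intro equalityI subsetI)
    fix y assume y: "y \<in> (\<Inter>n\<in>{1..}. word_map \<phi> (word_prefix \<omega> n) ` F)"
    have "dist y z \<le> c ^ n * diameter F" if "n \<ge> 1" for n
    proof -
      have "y \<in> ?P n" using y that by (auto simp: piece_def)
      then show ?thesis using diameter_piece_le[OF lists _ z] by fastforce
    qed
    moreover have "(\<lambda>n. c ^ n * diameter F) \<longlonglongrightarrow> 0 * diameter F"
      using c_pos c_less_1 by (intro tendsto_intros LIMSEQ_realpow_zero) auto
    ultimately have "dist y z \<le> 0"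
      by (intro tendsto_lowerbound[of "\<lambda>n. c ^ n * diameter F" _ sequentially])
        (auto simp: eventually_sequentially)
    then show "y \<in> {z}" by simp
  qed (use z in \<open>auto simp: piece_def\<close>)
  then have "coding_map \<phi> F \<omega> = z" by (simp add: coding_map_def)
  then show ?thesis using z by simp
qed

text \<open>Pieces of equal length are disjoint, so a point determines the prefixes of its code.
  Cylinders are thus exact preimages of pieces, and their masses agree.\<close>

lemma coding_map_in_piece_iff:
  assumes "range \<omega> \<subseteq> \<Lambda>" "w \<in> lists \<Lambda>"
  shows "coding_map \<phi> F \<omega> \<in> piece w \<longleftrightarrow> \<omega> \<in> cylinder \<Lambda> w"
  using coding_map_in_piece[OF assms(1), of "length w"] word_prefix_in_lists[OF assms(1), of "length w"]
    piece_disjoint[of "word_prefix \<omega> (length w)" w] assms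
  by (auto simp: cylinder_def)

lemma topspace_word_topology: "topspace (word_topology \<Lambda>) = {\<omega>. range \<omega> \<subseteq> \<Lambda>}"
  by (auto simp: word_topology_def PiE_def Pi_def)

lemma openin_cylinder:
  assumes "w \<in> lists \<Lambda>"
  shows "openin (word_topology \<Lambda>) (cylinder \<Lambda> w)"
proof -
  let ?A = "\<lambda>k. if k < length w then {w ! k} else \<Lambda>"
  have eq: "cylinder \<Lambda> w = (\<Pi>\<^sub>E k\<in>UNIV. ?A k)"
  proof (intro equalityI subsetI)
    fix \<omega> assume \<omega>: "\<omega> \<in> cylinder \<Lambda> w"
    then have "\<omega> k = w ! k" if "k < length w" for k
      using that nth_map[of k "[0..<length w]" \<omega>] by (simp add: cylinder_def word_prefix_def)
    then show "\<omega> \<in> (\<Pi>\<^sub>E k\<in>UNIV. ?A k)" using \<omega> by (auto simp: cylinder_def)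
  next
    fix \<omega> assume \<omega>: "\<omega> \<in> (\<Pi>\<^sub>E k\<in>UNIV. ?A k)"
    then have *: "\<omega> k \<in> ?A k" for k by (rule PiE_mem) simp
    then have "\<omega> k = w ! k" if "k < length w" for k using *[of k] that by simp
    then have "word_prefix \<omega> (length w) = w"
      by (intro nth_equalityI) (auto simp: word_prefix_def)
    moreover have "\<omega> k \<in> \<Lambda>" for k
      using *[of k] assms by (auto split: if_splits simp: in_lists_conv_set)
    ultimately show "\<omega> \<in> cylinder \<Lambda> w" by (auto simp: cylinder_def)
  qed
  have fin: "finite {k. ?A k \<noteq> topspace (discrete_topology \<Lambda>)}"
    by (rule finite_subset[of _ "{..<length w}"]) auto
  have "\<And>k. openin (discrete_topology \<Lambda>) (?A k)"
    using assms by (auto simp: in_lists_conv_set)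
  with fin show ?thesis unfolding word_topology_def eq
    by (intro product_topology_basis) auto
qed

text \<open>The coding map is continuous: a long prefix confines the image to a piece of small
  diameter.\<close>

lemma measurable_coding_map:
  assumes "space \<nu> = topspace (word_topology \<Lambda>)" "sets \<nu> = sets (word_borel \<Lambda>)"
  shows "coding_map \<phi> F \<in> measurable \<nu> (restrict_space borel F)"
proof (rule measurable_restrict_space2)
  show "coding_map \<phi> F \<in> space \<nu> \<rightarrow> F"
    using coding_map_in_piece[of _ 0] assms by (auto simp: topspace_word_topology word_prefix_def)
  have openin_sets: "U \<in> sets \<nu>" if "openin (word_topology \<Lambda>) U" for U
    unfolding assms word_borel_def using that openin_subset[of "word_topology \<Lambda>"]
    by (subst sets_measure_of) auto
  show "coding_map \<phi> F \<in> borel_measurable \<nu>"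
  proof (rule borel_measurableI)
    fix S :: "'a set" assume "open S"
    have "openin (word_topology \<Lambda>) (coding_map \<phi> F -` S \<inter> space \<nu>)"
    proof (subst openin_subopen, intro ballI)
      fix \<omega> assume "\<omega> \<in> coding_map \<phi> F -` S \<inter> space \<nu>"
      then have \<omega>: "range \<omega> \<subseteq> \<Lambda>" "coding_map \<phi> F \<omega> \<in> S"
        using assms by (auto simp: topspace_word_topology)
      obtain e where "e > 0" and e: "ball (coding_map \<phi> F \<omega>) e \<subseteq> S"
        using \<open>open S\<close> \<omega> open_contains_ball by blast
      have "(\<lambda>n. c ^ n * diameter F) \<longlonglongrightarrow> 0 * diameter F"
        using c_pos c_less_1 by (intro tendsto_intros LIMSEQ_realpow_zero) auto
      then have "eventually (\<lambda>n. c ^ n * diameter F < e) sequentially"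
        using \<open>e > 0\<close> by (intro order_tendstoD) auto
      then obtain n where n: "c ^ n * diameter F < e" by (auto simp: eventually_sequentially)
      let ?w = "word_prefix \<omega> n"
      have w: "?w \<in> lists \<Lambda>" using word_prefix_in_lists \<omega> by blast
      have "cylinder \<Lambda> ?w \<subseteq> coding_map \<phi> F -` S \<inter> space \<nu>"
      proof
        fix \<tau> assume \<tau>: "\<tau> \<in> cylinder \<Lambda> ?w"
        then have "range \<tau> \<subseteq> \<Lambda>" by (auto simp: cylinder_def)
        then have "coding_map \<phi> F \<tau> \<in> piece ?w" using coding_map_in_piece_iff[OF _ w] \<tau> by blast
        then have "dist (coding_map \<phi> F \<omega>) (coding_map \<phi> F \<tau>) < e"
          using diameter_piece_le[OF w coding_map_in_piece[OF \<omega>(1)]] n by fastforce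
        then show "\<tau> \<in> coding_map \<phi> F -` S \<inter> space \<nu>"
          using e \<open>range \<tau> \<subseteq> \<Lambda>\<close> assms by (auto simp: topspace_word_topology)
      qed
      moreover have "\<omega> \<in> cylinder \<Lambda> ?w" using \<omega> by (auto simp: cylinder_def)
      ultimately show "\<exists>T. openin (word_topology \<Lambda>) T \<and> \<omega> \<in> T \<and> T \<subseteq> coding_map \<phi> F -` S \<inter> space \<nu>"
        using openin_cylinder[OF w] by blast
    qed
    then show "coding_map \<phi> F -` S \<inter> space \<nu> \<in> sets \<nu>" by (rule openin_sets)
  qed
qed

lemma piece_in_sets: "w \<in> lists \<Lambda> \<Longrightarrow> piece w \<in> sets (restrict_space borel F)"
  using piece_subset compact_piece compact_F
  by (subst sets_restrict_space_iff) (auto intro: borel_compact)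

text \<open>Moves the hypothesis from symbolic space to \<open>F\<close>; from here on masses of
  pieces replace masses of cylinders.\<close>

lemma quasi_bernoulli_on_pieces:
  assumes "quasi_bernoulli_on \<Lambda> \<phi> F \<mu>"
  obtains C where "prob_space \<mu>" "sets \<mu> = sets (restrict_space borel F)" "C \<ge> 1"
    "\<And>u v. u \<in> lists \<Lambda> \<Longrightarrow> v \<in> lists \<Lambda> \<Longrightarrow>
      measure \<mu> (piece u) * measure \<mu> (piece v) \<le> C * measure \<mu> (piece (u @ v))"
    "\<And>u v. u \<in> lists \<Lambda> \<Longrightarrow> v \<in> lists \<Lambda> \<Longrightarrow>
      measure \<mu> (piece (u @ v)) \<le> C * (measure \<mu> (piece u) * measure \<mu> (piece v))"
proof -
  obtain \<nu> where qb: "quasi_bernoulli \<Lambda> \<nu>" and \<mu>: "\<mu> = distr \<nu> (restrict_space borel F) (coding_map \<phi> F)"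
    using assms by (auto simp: quasi_bernoulli_on_def)
  then have sp: "space \<nu> = topspace (word_topology \<Lambda>)" "sets \<nu> = sets (word_borel \<Lambda>)"
    and "prob_space \<nu>" by (auto simp: quasi_bernoulli_def)
  note meas = measurable_coding_map[OF sp]
  have m: "measure \<mu> (piece w) = measure \<nu> (cylinder \<Lambda> w)" if "w \<in> lists \<Lambda>" for w
  proof -
    have "coding_map \<phi> F -` piece w \<inter> space \<nu> = cylinder \<Lambda> w"
      using coding_map_in_piece_iff[OF _ that] unfolding sp(1) topspace_word_topology
      by (auto simp: cylinder_def)
    then show ?thesis unfolding \<mu> using measure_distr[OF meas piece_in_sets[OF that]] by simp
  qed
  obtain C where "C \<ge> 1" and C: "\<forall>u\<in>lists \<Lambda>. \<forall>v\<in>lists \<Lambda>.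
        inverse C * measure \<nu> (cylinder \<Lambda> u) * measure \<nu> (cylinder \<Lambda> v)
          \<le> measure \<nu> (cylinder \<Lambda> (u @ v)) \<and>
        measure \<nu> (cylinder \<Lambda> (u @ v))
          \<le> C * measure \<nu> (cylinder \<Lambda> u) * measure \<nu> (cylinder \<Lambda> v)"
    using qb by (auto simp: quasi_bernoulli_def)
  show ?thesis
  proof
    show "prob_space \<mu>" unfolding \<mu> by (rule prob_space.prob_space_distr) fact+
    show "sets \<mu> = sets (restrict_space borel F)" by (simp add: \<mu>)
  qed (use C m \<open>C \<ge> 1\<close> in \<open>auto simp: field_simps\<close>)
qed

end

section \<open>Comparison of pieces with balls\<close>

locale distorted_ifs = separated_ifs \<Lambda> \<phi> F c
  for \<Lambda> :: "'i set" and \<phi> :: "'i \<Rightarrow> 'a::euclidean_space \<Rightarrow> 'a" and F c +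
  fixes K :: real and x0 y0 :: 'a
  assumes distortion: "\<And>w x y x' y'. w \<in> lists \<Lambda> \<Longrightarrow> x \<in> F \<Longrightarrow> y \<in> F \<Longrightarrow> x' \<in> F \<Longrightarrow> y' \<in> F \<Longrightarrow>
     dist (word_map \<phi> w x) (word_map \<phi> w y) * dist x' y'
       \<le> K * (dist (word_map \<phi> w x') (word_map \<phi> w y') * dist x y)"
    and K_pos: "K > 0"
    and base_points: "x0 \<in> F" "y0 \<in> F" "x0 \<noteq> y0"
begin

text \<open>The ratio \<open>L(w)\<close> of the overview, read off the base points. By distortion
  any other pair of distinct points of \<open>F\<close> would give a comparable value.\<close>

definition scale :: "'i list \<Rightarrow> real" where
  "scale w = dist (word_map \<phi> w x0) (word_map \<phi> w y0)"

text \<open>The first entry serves the upper comparison of image distances with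
  \<open>scale\<close>, the second the lower one.\<close>

definition M :: real where
  "M = max (K / dist x0 y0) (K * dist x0 y0)"

lemma dist_base_pos: "dist x0 y0 > 0"
  using base_points by simp

lemma M_pos: "M > 0"
  using K_pos base_points by (simp add: M_def less_max_iff_disj)

lemma scale_pos: "w \<in> lists \<Lambda> \<Longrightarrow> scale w > 0"
  using inj_onD[OF inj_word_map] base_points by (fastforce simp: scale_def)

lemma scale_le: "w \<in> lists \<Lambda> \<Longrightarrow> scale w \<le> c ^ length w * dist x0 y0"
  using word_map_contraction base_points by (simp add: scale_def)

lemma scale_le_base:
  assumes "w \<in> lists \<Lambda>"
  shows "scale w \<le> dist x0 y0"
proof -
  have "c ^ length w * dist x0 y0 \<le> 1 * dist x0 y0"
    using c_pos c_less_1 by (intro mult_right_mono power_le_one) auto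
  then show ?thesis using scale_le[OF assms] by simp
qed

lemma dist_word_map_le_scale:
  assumes "w \<in> lists \<Lambda>" "x \<in> F" "y \<in> F"
  shows "dist (word_map \<phi> w x) (word_map \<phi> w y) \<le> M * scale w * dist x y"
proof -
  have "dist (word_map \<phi> w x) (word_map \<phi> w y) \<le> K / dist x0 y0 * (scale w * dist x y)"
    using distortion[OF assms base_points(1,2)] dist_base_pos by (simp add: scale_def field_simps)
  also have "\<dots> \<le> M * (scale w * dist x y)"
    by (intro mult_right_mono) (auto simp: M_def scale_def)
  finally show ?thesis by simp
qed

lemma scale_le_dist_word_map:
  assumes "w \<in> lists \<Lambda>" "x \<in> F" "y \<in> F"
  shows "scale w * dist x y \<le> M * dist (word_map \<phi> w x) (word_map \<phi> w y)"
proof -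
  have "scale w * dist x y \<le> K * dist x0 y0 * dist (word_map \<phi> w x) (word_map \<phi> w y)"
    using distortion[OF assms(1) base_points(1,2) assms(2,3)] by (simp add: scale_def mult_ac)
  also have "\<dots> \<le> M * dist (word_map \<phi> w x) (word_map \<phi> w y)"
    by (intro mult_right_mono) (auto simp: M_def)
  finally show ?thesis .
qed

lemma scale_append_le: "u \<in> lists \<Lambda> \<Longrightarrow> v \<in> lists \<Lambda> \<Longrightarrow> scale (u @ v) \<le> M * scale u * scale v"
  using dist_word_map_le_scale[of u "word_map \<phi> v x0" "word_map \<phi> v y0"] base_points word_map_in_F
  by (simp add: scale_def)

lemma scale_append_ge: "u \<in> lists \<Lambda> \<Longrightarrow> v \<in> lists \<Lambda> \<Longrightarrow> scale u * scale v \<le> M * scale (u @ v)"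
  using scale_le_dist_word_map[of u "word_map \<phi> v x0" "word_map \<phi> v y0"] base_points word_map_in_F
  by (simp add: scale_def)

text \<open>Along a code the scale drops by a bounded factor per letter, so a prefix of scale
  comparable to a given small radius always exists.\<close>

lemma scale_snoc_ge: "\<exists>b>0. \<forall>u\<in>lists \<Lambda>. \<forall>i\<in>\<Lambda>. b * scale u \<le> scale (u @ [i])"
proof -
  define b where "b = Min ((\<lambda>i. scale [i]) ` \<Lambda>) / M"
  have "\<Lambda> \<noteq> {}" using F_eq F_nonempty by auto
  then have "b > 0" using scale_pos M_pos finite_alphabet by (auto simp: b_def)
  moreover have "b * scale u \<le> scale (u @ [i])" if "u \<in> lists \<Lambda>" "i \<in> \<Lambda>" for u i
  proof -
    have "Min ((\<lambda>i. scale [i]) ` \<Lambda>) \<le> scale [i]" using that finite_alphabet by simp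
    then have "b * scale u \<le> scale [i] / M * scale u"
      using M_pos scale_pos[OF that(1)] unfolding b_def
      by (intro mult_right_mono divide_right_mono) auto
    also have "\<dots> \<le> scale (u @ [i])"
      using scale_append_ge[of u "[i]"] that M_pos by (simp add: field_simps)
    finally show ?thesis .
  qed
  ultimately show ?thesis by blast
qed

lemma piece_subset_cball:
  "\<exists>A>0. \<forall>w\<in>lists \<Lambda>. \<forall>y\<in>piece w. piece w \<subseteq> cball y (A * scale w)"
proof -
  have "piece w \<subseteq> cball y (M * (diameter F + 1) * scale w)" if w: "w \<in> lists \<Lambda>" and "y \<in> piece w" for w y
  proof
    fix z assume "z \<in> piece w"
    then obtain a b where ab: "a \<in> F" "b \<in> F" "y = word_map \<phi> w a" "z = word_map \<phi> w b"
      using \<open>y \<in> piece w\<close> by (auto simp: piece_def)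
    have "dist y z \<le> M * scale w * dist a b" using dist_word_map_le_scale w ab by simp
    also have "\<dots> \<le> M * scale w * (diameter F + 1)"
      using diameter_bounded_bound[OF bounded_F ab(1,2)] M_pos scale_pos[OF w]
      by (intro mult_left_mono) auto
    finally show "z \<in> cball y (M * (diameter F + 1) * scale w)" by (simp add: mult_ac)
  qed
  moreover have "M * (diameter F + 1) > 0"
    using M_pos diameter_ge_0[OF bounded_F] by (intro mult_pos_pos) auto
  ultimately show ?thesis by blast
qed

lemma first_level_separated:
  "\<exists>\<delta>>0. \<forall>i\<in>\<Lambda>. \<forall>j\<in>\<Lambda>. i \<noteq> j \<longrightarrow> (\<forall>x\<in>\<phi> i ` F. \<forall>y\<in>\<phi> j ` F. \<delta> \<le> dist x y)"
proof -
  have "\<exists>\<delta>>0. \<forall>x\<in>\<phi> i ` F. \<forall>y\<in>\<phi> j ` F. \<delta> \<le> dist x y" if "i \<in> \<Lambda>" "j \<in> \<Lambda>" "i \<noteq> j" for i j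
  proof (rule separate_compact_closed)
    show "compact (\<phi> i ` F)" "closed (\<phi> j ` F)"
      using compact_piece[of "[i]"] compact_piece[of "[j]"] that compact_imp_closed
      by (auto simp: piece_def)
    show "\<phi> i ` F \<inter> \<phi> j ` F = {}" using separation that by (auto simp: strong_separation_def)
  qed
  then obtain d where d: "\<And>i j. i \<in> \<Lambda> \<Longrightarrow> j \<in> \<Lambda> \<Longrightarrow> i \<noteq> j \<Longrightarrow>
      d i j > 0 \<and> (\<forall>x\<in>\<phi> i ` F. \<forall>y\<in>\<phi> j ` F. d i j \<le> dist x y)" by metis
  define \<delta> where "\<delta> = Min (insert 1 ((\<lambda>(i, j). d i j) ` {(i, j) \<in> \<Lambda> \<times> \<Lambda>. i \<noteq> j}))"
  have fin: "finite (insert 1 ((\<lambda>(i, j). d i j) ` {(i, j) \<in> \<Lambda> \<times> \<Lambda>. i \<noteq> j}))"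
    using finite_alphabet by (auto intro: finite_subset[of _ "\<Lambda> \<times> \<Lambda>"])
  have "\<delta> > 0" unfolding \<delta>_def using fin d by (subst Min_gr_iff) auto
  moreover have "\<delta> \<le> d i j" if "i \<in> \<Lambda>" "j \<in> \<Lambda>" "i \<noteq> j" for i j
    unfolding \<delta>_def using fin that by (intro Min_le) auto
  ultimately show ?thesis using d by (intro exI[of _ \<delta>]) (meson order_trans)
qed

text \<open>A point of \<open>F\<close> outside \<open>piece w\<close> lies in another piece of the
  same length. At the longest common prefix \<open>p\<close> the two points are separated by the
  first-level gap, scaled by \<open>scale p\<close>, and \<open>scale w\<close> is at most a
  constant times \<open>scale p\<close>.\<close>

lemma cball_subset_piece:
  "\<exists>a>0. \<forall>w\<in>lists \<Lambda>. \<forall>y\<in>piece w. cball y (a * scale w) \<inter> F \<subseteq> piece w"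
proof -
  obtain \<delta> where "\<delta> > 0" and \<delta>: "\<And>i j x y. i \<in> \<Lambda> \<Longrightarrow> j \<in> \<Lambda> \<Longrightarrow> i \<noteq> j \<Longrightarrow> x \<in> F \<Longrightarrow> y \<in> F \<Longrightarrow> \<delta> \<le> dist (\<phi> i x) (\<phi> j y)"
    using first_level_separated by fastforce
  \<comment> \<open>One \<open>M\<close> pays for the distortion of \<open>p\<close>, one for
    splitting \<open>scale w\<close> after \<open>p\<close>, and \<open>dist x0 y0\<close> bounds
    the scale of the remainder. The factor 2 makes the final inequality contradictory.\<close>
  define a where "a = \<delta> / (2 * M * M * dist x0 y0)"
  have "a > 0" using \<open>\<delta> > 0\<close> M_pos dist_base_pos by (simp add: a_def)
  moreover have "cball y (a * scale w) \<inter> F \<subseteq> piece w" if w: "w \<in> lists \<Lambda>" "y \<in> piece w" for w y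
  proof
    fix z assume z: "z \<in> cball y (a * scale w) \<inter> F"
    obtain v where v: "v \<in> lists \<Lambda>" "length v = length w" "z \<in> piece v"
      using in_some_piece z by blast
    show "z \<in> piece w"
    proof (rule ccontr)
      assume "z \<notin> piece w"
      then have "w \<noteq> v" using v by auto
      then obtain p i w' j v' where "i \<noteq> j" and dec: "w = p @ [i] @ w'" "v = p @ [j] @ v'"
        using same_length_different[of w v] v by metis
      then have lists: "p \<in> lists \<Lambda>" "i \<in> \<Lambda>" "j \<in> \<Lambda>" "w' \<in> lists \<Lambda>" "v' \<in> lists \<Lambda>"
        using w v by auto
      obtain s t where st: "s \<in> F" "t \<in> F" "y = word_map \<phi> p (\<phi> i s)" "z = word_map \<phi> p (\<phi> j t)"
        using w v dec piece_append_subset[OF lists(4), of "p @ [i]"]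
          piece_append_subset[OF lists(5), of "p @ [j]"]
        by (fastforce simp: piece_def[of "p @ [i]"] piece_def[of "p @ [j]"])
      have "scale p * \<delta> \<le> scale p * dist (\<phi> i s) (\<phi> j t)"
        using \<delta> lists st \<open>i \<noteq> j\<close> scale_pos[OF lists(1)] by (intro mult_left_mono) auto
      also have "\<dots> \<le> M * dist y z"
        using scale_le_dist_word_map[OF lists(1)] lists st map_in_F by auto
      also have "\<dots> \<le> M * (a * scale w)" using z M_pos by (intro mult_left_mono) auto
      also have "scale w \<le> M * scale p * scale ([i] @ w')"
        unfolding dec using lists by (intro scale_append_le) auto
      also have "\<dots> \<le> M * scale p * dist x0 y0"
        using lists M_pos scale_pos[OF lists(1)] by (intro mult_left_mono scale_le_base) auto
      finally have "scale p * \<delta> \<le> M * (a * (M * scale p * dist x0 y0))"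
        using M_pos \<open>a > 0\<close> by simp
      also have "\<dots> = scale p * \<delta> / 2" using M_pos dist_base_pos by (simp add: a_def field_simps)
      finally show False using scale_pos[OF lists(1)] \<open>\<delta> > 0\<close> by simp
    qed
  qed
  ultimately show ?thesis by blast
qed

end

section \<open>Quasi-Bernoulli measures\<close>

locale quasi_bernoulli_ifs = distorted_ifs \<Lambda> \<phi> F c K x0 y0 + prob_space \<mu>
  for \<Lambda> :: "'i set" and \<phi> :: "'i \<Rightarrow> 'a::euclidean_space \<Rightarrow> 'a" and F c K x0 y0
    and \<mu> :: "'a measure" +
  fixes C :: real
  assumes sets_\<mu>: "sets \<mu> = sets (restrict_space borel F)"
    and full_support: "fully_supported_on F \<mu>"
    and C_ge_1: "C \<ge> 1"
    and quasi_ge: "\<And>u v. u \<in> lists \<Lambda> \<Longrightarrow> v \<in> lists \<Lambda> \<Longrightarrow>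
      measure \<mu> (piece u) * measure \<mu> (piece v) \<le> C * measure \<mu> (piece (u @ v))"
    and quasi_le: "\<And>u v. u \<in> lists \<Lambda> \<Longrightarrow> v \<in> lists \<Lambda> \<Longrightarrow>
      measure \<mu> (piece (u @ v)) \<le> C * (measure \<mu> (piece u) * measure \<mu> (piece v))"
begin

lemma space_\<mu>: "space \<mu> = F"
  using sets_eq_imp_space_eq[OF sets_\<mu>] by (simp add: space_restrict_space)

lemma piece_sets: "w \<in> lists \<Lambda> \<Longrightarrow> piece w \<in> sets \<mu>"
  using piece_in_sets sets_\<mu> by simp

lemma closed_Int_sets: "closed S \<Longrightarrow> S \<inter> F \<in> sets \<mu>"
  unfolding sets_\<mu> using compact_F
  by (subst sets_restrict_space_iff) (auto intro: borel_closed borel_compact sets.Int)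

lemma measure_cball_pos:
  assumes "x \<in> F" "r > 0"
  shows "measure \<mu> (cball x r \<inter> F) > 0"
proof -
  have "openin (top_of_set F) (F \<inter> ball x r)" by (simp add: openin_open_Int)
  moreover have "x \<in> measure_support F \<mu>"
    using full_support assms by (simp add: fully_supported_on_def)
  ultimately have "emeasure \<mu> (F \<inter> ball x r) > 0"
    using assms by (auto simp: measure_support_def)
  also have "\<dots> \<le> emeasure \<mu> (cball x r \<inter> F)"
    by (intro emeasure_mono closed_Int_sets) auto
  finally show ?thesis by (simp add: emeasure_eq_measure)
qed

text \<open>Full support only speaks about open sets; separation supplies a ball of \<open>F\<close>
  inside each piece.\<close>

lemma measure_piece_pos:
  assumes "w \<in> lists \<Lambda>"
  shows "measure \<mu> (piece w) > 0"
proof -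
  obtain a where "a > 0" and a: "\<And>y. y \<in> piece w \<Longrightarrow> cball y (a * scale w) \<inter> F \<subseteq> piece w"
    using cball_subset_piece assms by blast
  obtain y where y: "y \<in> piece w" using piece_nonempty by blast
  have "0 < measure \<mu> (cball y (a * scale w) \<inter> F)"
    using y piece_subset[OF assms] \<open>a > 0\<close> scale_pos[OF assms] by (intro measure_cball_pos) auto
  also have "\<dots> \<le> measure \<mu> (piece w)"
    by (intro finite_measure_mono a y piece_sets assms)
  finally show ?thesis .
qed

lemma measure_piece_Nil: "measure \<mu> (piece []) = 1"
  using prob_space space_\<mu> by simp

lemma measure_piece_sum:
  assumes u: "u \<in> lists \<Lambda>"
  shows "measure \<mu> (piece u) = (\<Sum>w | w \<in> lists \<Lambda> \<and> length w = n. measure \<mu> (piece (u @ w)))"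
proof -
  let ?W = "{w \<in> lists \<Lambda>. length w = n}"
  have "measure \<mu> (\<Union>w\<in>?W. piece (u @ w)) = (\<Sum>w\<in>?W. measure \<mu> (piece (u @ w)))"
  proof (rule finite_measure_finite_Union[OF finite_words])
    show "(\<lambda>w. piece (u @ w)) ` ?W \<subseteq> sets \<mu>" using u by (auto intro!: piece_sets)
    show "disjoint_family_on (\<lambda>w. piece (u @ w)) ?W"
      unfolding disjoint_family_on_def using u by (intro ballI impI piece_disjoint) auto
  qed
  then show ?thesis using piece_eq_Union[OF u, of n] by simp
qed

text \<open>
  Quasi-Bernoullicity replaces ergodicity: every block of length \<open>length v\<close> has conditional
  probability at least \<open>measure \<mu> (piece v) / C\<close> of being \<open>v\<close>.
\<close>

lemma AE_contains_word:
  assumes v: "v \<in> lists \<Lambda>"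
  shows "AE x in \<mu>. \<exists>u\<in>lists \<Lambda>. x \<in> piece (u @ v)"
proof -
  define N where "N = F - (\<Union>u\<in>lists \<Lambda>. piece (u @ v))"
  have "countable (lists \<Lambda>)" by (simp add: countable_finite finite_alphabet)
  then have "(\<Union>u\<in>lists \<Lambda>. piece (u @ v)) \<in> sets \<mu>"
    using v by (intro sets.countable_UN') (auto intro!: piece_sets)
  then have N: "N \<in> sets \<mu>" using piece_sets[of "[]"] by (auto simp: N_def)
  define \<theta> where "\<theta> = 1 - measure \<mu> (piece v) / C"
  have "measure \<mu> (piece v) \<le> C" using prob_le_1[of "piece v"] C_ge_1 by linarith
  then have \<theta>: "0 \<le> \<theta>" "\<theta> < 1" using measure_piece_pos[OF v] C_ge_1 by (auto simp: \<theta>_def)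
  \<comment> \<open>The bound is uniform in \<open>u\<close> because the induction passes to the
    children \<open>u @ w\<close> with \<open>w\<close> as long as \<open>v\<close>. The child
    \<open>u @ v\<close> misses \<open>N\<close>, and the remaining children carry at most the
    fraction \<open>\<theta>\<close> of the mass.\<close>
  have "measure \<mu> (N \<inter> piece u) \<le> \<theta> ^ k * measure \<mu> (piece u)" if "u \<in> lists \<Lambda>" for u k
    using that
  proof (induction k arbitrary: u)
    case 0
    then show ?case by (auto intro!: finite_measure_mono piece_sets)
  next
    case (Suc k)
    let ?W = "{w \<in> lists \<Lambda>. length w = length v}"
    have fin: "finite (?W - {v})" using finite_words by simp
    have "N \<inter> piece (u @ v) = {}" using Suc.prems by (auto simp: N_def)
    then have eq: "N \<inter> piece u = (\<Union>w\<in>?W - {v}. N \<inter> piece (u @ w))"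
      using piece_eq_Union[OF Suc.prems, of "length v"] by auto
    have "measure \<mu> (N \<inter> piece u) \<le> (\<Sum>w\<in>?W - {v}. measure \<mu> (N \<inter> piece (u @ w)))"
      unfolding eq using fin N Suc.prems
      by (intro finite_measure_subadditive_finite) (auto intro!: sets.Int piece_sets)
    also have "\<dots> \<le> (\<Sum>w\<in>?W - {v}. \<theta> ^ k * measure \<mu> (piece (u @ w)))"
      using Suc.prems by (intro sum_mono Suc.IH) auto
    also have "\<dots> = \<theta> ^ k * (measure \<mu> (piece u) - measure \<mu> (piece (u @ v)))"
      using measure_piece_sum[OF Suc.prems, of "length v"] v finite_words[of "length v"]
      by (simp add: sum_diff1 flip: sum_distrib_left)
    also have "\<dots> \<le> \<theta> ^ k * (\<theta> * measure \<mu> (piece u))"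
    proof (intro mult_left_mono)
      show "measure \<mu> (piece u) - measure \<mu> (piece (u @ v)) \<le> \<theta> * measure \<mu> (piece u)"
        using quasi_ge[OF Suc.prems v] C_ge_1 by (simp add: \<theta>_def field_simps)
    qed (use \<theta> in auto)
    finally show ?case by (simp add: mult_ac)
  qed
  from this[of "[]"] have "measure \<mu> N \<le> \<theta> ^ k" for k
    using measure_piece_Nil by (simp add: N_def Int_absorb2)
  moreover have "(\<lambda>k. \<theta> ^ k) \<longlonglongrightarrow> 0" using \<theta> by (intro LIMSEQ_realpow_zero) auto
  ultimately have "measure \<mu> N \<le> 0" by (intro LIMSEQ_le_const) auto
  then have "measure \<mu> N = 0" by (simp add: measure_le_0_iff)
  then have "N \<in> null_sets \<mu>" using N by (auto simp: null_sets_def emeasure_eq_measure)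
  then show ?thesis by (rule AE_I') (auto simp: N_def space_\<mu>)
qed

lemma AE_contains_all_words: "AE x in \<mu>. \<forall>v\<in>lists \<Lambda>. \<exists>u\<in>lists \<Lambda>. x \<in> piece (u @ v)"
  by (intro AE_ball_countable' AE_contains_word) (auto simp: countable_finite finite_alphabet)

section \<open>Exponents at one point, lower bounds on pieces, exponents at all points\<close>

lemma pointwise_bound_imp_piece_bound:
  assumes x: "x \<in> F" and recurrent: "\<And>v. v \<in> lists \<Lambda> \<Longrightarrow> \<exists>u\<in>lists \<Lambda>. x \<in> piece (u @ v)"
    and "s > 0" "D > 0"
    and D: "\<And>r R. 0 < r \<Longrightarrow> r < R \<Longrightarrow>
        measure \<mu> (cball x R \<inter> F) / measure \<mu> (cball x r \<inter> F) \<le> D * (R / r) powr s"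
  shows "\<exists>k>0. \<forall>v\<in>lists \<Lambda>. k * scale v powr s \<le> measure \<mu> (piece v)"
proof -
  obtain A0 where "A0 > 0" and A0: "\<And>w y. w \<in> lists \<Lambda> \<Longrightarrow> y \<in> piece w \<Longrightarrow> piece w \<subseteq> cball y (A0 * scale w)"
    using piece_subset_cball by blast
  obtain a where "a > 0" and a: "\<And>w y. w \<in> lists \<Lambda> \<Longrightarrow> y \<in> piece w \<Longrightarrow> cball y (a * scale w) \<inter> F \<subseteq> piece w"
    using cball_subset_piece by blast
  \<comment> \<open>\<open>A0\<close> makes the outer ball cover \<open>piece u\<close>. The other
    summand forces \<open>r < R\<close> below for every \<open>v\<close>, including short words and
    the empty one, where \<open>scale v\<close> is not small.\<close>
  define A where "A = A0 + a * M * dist x0 y0"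
  have "A > 0" "A0 \<le> A" using \<open>A0 > 0\<close> \<open>a > 0\<close> M_pos dist_base_pos by (auto simp: A_def add_pos_pos)
  \<comment> \<open>Solves \<open>D * (A * M / a / scale v) powr s = 1 / (C * (k * scale v powr
    s))\<close>; the factor \<open>C\<close> then cancels against the one from
    \<open>quasi_le\<close>.\<close>
  define k where "k = (a / (A * M)) powr s / (C * D)"
  have "k > 0" using \<open>a > 0\<close> \<open>A > 0\<close> M_pos C_ge_1 \<open>D > 0\<close> by (simp add: k_def)
  moreover have "k * scale v powr s \<le> measure \<mu> (piece v)" if v: "v \<in> lists \<Lambda>" for v
  proof -
    obtain u where u: "u \<in> lists \<Lambda>" and xuv: "x \<in> piece (u @ v)" using recurrent[OF v] by blast
    then have uv: "u @ v \<in> lists \<Lambda>" and xu: "x \<in> piece u" using v piece_append_subset by auto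
    note pos = scale_pos[OF u] scale_pos[OF v] scale_pos[OF uv]
    define R where "R = A * scale u"
    define r where "r = a * scale (u @ v)"
    have "r > 0" "R > 0" using pos \<open>a > 0\<close> \<open>A > 0\<close> by (auto simp: r_def R_def)
    have "r \<le> a * (M * scale u * scale v)"
      using scale_append_le[OF u v] \<open>a > 0\<close> by (simp add: r_def)
    also have "\<dots> \<le> a * (M * scale u * dist x0 y0)"
      using scale_le_base[OF v] \<open>a > 0\<close> M_pos pos by (intro mult_left_mono) auto
    also have "\<dots> < R" using \<open>A0 > 0\<close> pos by (simp add: R_def A_def algebra_simps)
    finally have "r < R" .
    have "measure \<mu> (piece u) \<le> measure \<mu> (cball x R \<inter> F)"
    proof (intro finite_measure_mono closed_Int_sets)
      have "A0 * scale u \<le> R" using \<open>A0 \<le> A\<close> pos by (simp add: R_def)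
      then show "piece u \<subseteq> cball x R \<inter> F" using A0[OF u xu] piece_subset[OF u] by fastforce
    qed auto
    moreover have "measure \<mu> (cball x r \<inter> F) \<le> measure \<mu> (piece (u @ v))"
      using a[OF uv xuv] by (intro finite_measure_mono piece_sets uv) (simp add: r_def)
    ultimately have "measure \<mu> (piece u) / measure \<mu> (piece (u @ v))
        \<le> measure \<mu> (cball x R \<inter> F) / measure \<mu> (cball x r \<inter> F)"
      using measure_cball_pos[OF x \<open>r > 0\<close>] by (intro frac_le) auto
    also have "\<dots> \<le> D * (R / r) powr s" by (intro D \<open>r > 0\<close> \<open>r < R\<close>)
    also have "\<dots> \<le> D * (A * M / a / scale v) powr s"
    proof (intro mult_left_mono powr_mono2)
      show "R / r \<le> A * M / a / scale v"
        using scale_append_ge[OF u v] \<open>A > 0\<close> \<open>a > 0\<close> pos by (simp add: R_def r_def field_simps)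
    qed (use \<open>s > 0\<close> \<open>D > 0\<close> \<open>r > 0\<close> \<open>R > 0\<close> in auto)
    also have "\<dots> = 1 / (C * (k * scale v powr s))"
      using \<open>a > 0\<close> \<open>A > 0\<close> \<open>D > 0\<close> C_ge_1 M_pos pos by (simp add: k_def powr_divide powr_mult field_simps)
    finally have 1: "measure \<mu> (piece u) / measure \<mu> (piece (u @ v)) \<le> 1 / (C * (k * scale v powr s))" .
    have "1 / (C * measure \<mu> (piece v)) \<le> measure \<mu> (piece u) / measure \<mu> (piece (u @ v))"
      using quasi_le[OF u v] measure_piece_pos[OF u] measure_piece_pos[OF v] measure_piece_pos[OF uv] C_ge_1
      by (simp add: field_simps)
    then have "inverse (C * measure \<mu> (piece v)) \<le> inverse (C * (k * scale v powr s))"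
      using 1 unfolding inverse_eq_divide by linarith
    moreover have "0 < C * measure \<mu> (piece v)" using C_ge_1 measure_piece_pos[OF v] by simp
    ultimately have "C * (k * scale v powr s) \<le> C * measure \<mu> (piece v)"
      by (rule inverse_le_imp_le)
    then show ?thesis using C_ge_1 by simp
  qed
  ultimately show ?thesis by blast
qed

text \<open>Both radii are translated into prefixes of one code of \<open>y\<close>:
  \<open>piece u\<close> contains the outer ball, and \<open>piece (u @ v)\<close> lies in the inner
  one. The quotient of masses is then at most \<open>C / measure \<mu> (piece v)\<close>, while
  \<open>scale v\<close> is at least a constant times \<open>r / R\<close>.\<close>

lemma piece_bound_imp_global_bound:
  assumes "s > 0" "k > 0" and k: "\<And>v. v \<in> lists \<Lambda> \<Longrightarrow> k * scale v powr s \<le> measure \<mu> (piece v)"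
  shows "\<exists>D>0. \<forall>y\<in>F. \<forall>r R. 0 < r \<and> r < R \<longrightarrow>
        measure \<mu> (cball y R \<inter> F) / measure \<mu> (cball y r \<inter> F) \<le> D * (R / r) powr s"
proof -
  obtain A where "A > 0" and A: "\<And>w y. w \<in> lists \<Lambda> \<Longrightarrow> y \<in> piece w \<Longrightarrow> piece w \<subseteq> cball y (A * scale w)"
    using piece_subset_cball by blast
  obtain a where "a > 0" and a: "\<And>w y. w \<in> lists \<Lambda> \<Longrightarrow> y \<in> piece w \<Longrightarrow> cball y (a * scale w) \<inter> F \<subseteq> piece w"
    using cball_subset_piece by blast
  obtain b where "b > 0" and b: "\<And>u i. u \<in> lists \<Lambda> \<Longrightarrow> i \<in> \<Lambda> \<Longrightarrow> b * scale u \<le> scale (u @ [i])"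
    using scale_snoc_ge by blast
  \<comment> \<open>The entry 1 serves the case where \<open>v\<close> is empty. In the other, each
    of the two stopping rules below overshoots by at most one letter and costs one factor
    \<open>b\<close>.\<close>
  define K2 where "K2 = max 1 (A / (a * b * b))"
  have "K2 > 0" by (simp add: K2_def less_max_iff_disj)
  define D where "D = C / k * (M * K2) powr s"
  have "D > 0" using C_ge_1 \<open>k > 0\<close> M_pos \<open>K2 > 0\<close> by (simp add: D_def)
  moreover have "measure \<mu> (cball y R \<inter> F) / measure \<mu> (cball y r \<inter> F) \<le> D * (R / r) powr s"
    if y: "y \<in> F" and "0 < r" "r < R" for y r R
  proof -
    have "(\<lambda>n. A * (c ^ n * dist x0 y0)) \<longlonglongrightarrow> A * (0 * dist x0 y0)"
      using c_pos c_less_1 by (intro tendsto_intros LIMSEQ_realpow_zero) auto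
    then have "eventually (\<lambda>n. A * (c ^ n * dist x0 y0) < r) sequentially"
      using \<open>0 < r\<close> by (intro order_tendstoD) auto
    \<comment> \<open>A finite word this long can replace an infinite code of \<open>y\<close>: its
      piece already fits into the inner ball, so the search for \<open>n\<close> terminates.\<close>
    then obtain N where N: "A * (c ^ N * dist x0 y0) < r" by (auto simp: eventually_sequentially)
    obtain w where w: "w \<in> lists \<Lambda>" "length w = N" "y \<in> piece w" using in_some_piece[OF y] by blast
    have take_w: "take j w \<in> lists \<Lambda>" "y \<in> piece (take j w)" for j
    proof -
      have "w = take j w @ drop j w" by simp
      then have "take j w \<in> lists \<Lambda> \<and> drop j w \<in> lists \<Lambda>" using w by (metis append_in_lists_conv)
      then show "take j w \<in> lists \<Lambda>" "y \<in> piece (take j w)"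
        using piece_append_subset[of "drop j w" "take j w"] w by auto
    qed
    have step: "b * scale (take j w) \<le> scale (take (Suc j) w)" if "j < N" for j
      using b[OF take_w(1)] w that by (auto simp: take_Suc_conv_app_nth in_lists_conv_set)
    have "A * scale w \<le> A * (c ^ N * dist x0 y0)"
      using scale_le[OF w(1)] w \<open>A > 0\<close> by (intro mult_left_mono) auto
    then have ex: "A * scale (take N w) \<le> r" using N w by simp
    define n where "n = (LEAST j. A * scale (take j w) \<le> r)"
    have n: "A * scale (take n w) \<le> r" "n \<le> N" and n_min: "\<And>j. j < n \<Longrightarrow> r < A * scale (take j w)"
      using LeastI[of "\<lambda>j. A * scale (take j w) \<le> r", OF ex]
        Least_le[of "\<lambda>j. A * scale (take j w) \<le> r", OF ex]
        not_less_Least[of _ "\<lambda>j. A * scale (take j w) \<le> r"] by (auto simp: n_def not_le)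
    \<comment> \<open>The condition looks one letter ahead: every prefix of positive length up to
      \<open>m\<close> still has a piece containing the outer ball, and for \<open>m = 0\<close> the
      piece is all of \<open>F\<close>. The alternative \<open>j = n\<close> keeps \<open>u\<close>
      a prefix of \<open>take n w\<close>.\<close>
    define m where "m = (LEAST j. j = n \<or> a * scale (take (Suc j) w) < R)"
    have m: "m = n \<or> a * scale (take (Suc m) w) < R" "m \<le> n"
      and m_min: "\<And>j. j < m \<Longrightarrow> R \<le> a * scale (take (Suc j) w)"
      using LeastI[of "\<lambda>j. j = n \<or> a * scale (take (Suc j) w) < R" n]
        Least_le[of "\<lambda>j. j = n \<or> a * scale (take (Suc j) w) < R" n]
        not_less_Least[of _ "\<lambda>j. j = n \<or> a * scale (take (Suc j) w) < R"] by (auto simp: m_def not_less)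
    define u where "u = take m w"
    define v where "v = drop m (take n w)"
    have uv: "u @ v = take n w"
      using m(2) append_take_drop_id[of m "take n w"] by (simp add: u_def v_def min_absorb1)
    then have lists: "u \<in> lists \<Lambda>" "v \<in> lists \<Lambda>" "u @ v \<in> lists \<Lambda>"
      using take_w(1)[of n] by (metis append_in_lists_conv)+
    note pos = scale_pos[OF lists(1)] scale_pos[OF lists(2)] scale_pos[OF lists(3)]
    have upper: "measure \<mu> (cball y R \<inter> F) \<le> measure \<mu> (piece u)"
    proof (rule finite_measure_mono[OF _ piece_sets[OF lists(1)]])
      show "cball y R \<inter> F \<subseteq> piece u"
      proof (cases m)
        case 0
        then show ?thesis by (simp add: u_def)
      next
        case (Suc j)
        then have "R \<le> a * scale u" using m_min[of j] by (simp add: u_def)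
        then show ?thesis using a[OF lists(1), of y] take_w(2)[of m] by (fastforce simp: u_def)
      qed
    qed
    have lower: "measure \<mu> (piece (u @ v)) \<le> measure \<mu> (cball y r \<inter> F)"
    proof (intro finite_measure_mono closed_Int_sets)
      show "piece (u @ v) \<subseteq> cball y r \<inter> F"
        using A[OF lists(3), of y] take_w(2)[of n] n(1) piece_subset[OF lists(3)] unfolding uv by fastforce
    qed auto
    have ratio: "scale u \<le> K2 * (R / r) * scale (u @ v)"
    proof (cases "m = n")
      case True
      then have "u @ v = u" using uv by (simp add: u_def)
      moreover have "1 * 1 \<le> K2 * (R / r)"
        using \<open>0 < r\<close> \<open>r < R\<close> by (intro mult_mono) (auto simp: K2_def)
      ultimately show ?thesis using pos mult_right_mono[of 1 "K2 * (R / r)" "scale u"] by simp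
    next
      case False
      then have "m < n" using m by simp
      then obtain j where j: "n = Suc j" by (cases n) auto
      have "b * scale u \<le> scale (take (Suc m) w)" using step[of m] \<open>m < n\<close> n(2) by (simp add: u_def)
      then have "a * (b * scale u) \<le> a * scale (take (Suc m) w)"
        using \<open>a > 0\<close> by (intro mult_left_mono) auto
      then have 1: "a * (b * scale u) \<le> R" using m False by simp
      have "b * r \<le> b * (A * scale (take j w))" using n_min[of j] j \<open>b > 0\<close> by simp
      also have "\<dots> = A * (b * scale (take j w))" by simp
      also have "\<dots> \<le> A * scale (u @ v)"
        using step[of j] j n(2) \<open>A > 0\<close> by (intro mult_left_mono) (auto simp: uv)
      finally have 2: "b * r \<le> A * scale (u @ v)" .
      have "scale u \<le> R / (a * b)" using 1 \<open>a > 0\<close> \<open>b > 0\<close> by (simp add: field_simps)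
      also have "\<dots> = R / r / (a * b * b) * (b * r)" using \<open>0 < r\<close> \<open>b > 0\<close> by (simp add: field_simps)
      also have "\<dots> \<le> R / r / (a * b * b) * (A * scale (u @ v))"
        using 2 \<open>0 < r\<close> \<open>r < R\<close> \<open>a > 0\<close> \<open>b > 0\<close> by (intro mult_left_mono) auto
      also have "\<dots> = A / (a * b * b) * (R / r * scale (u @ v))" by (simp add: mult_ac)
      also have "\<dots> \<le> K2 * (R / r * scale (u @ v))"
        using \<open>0 < r\<close> \<open>r < R\<close> pos by (intro mult_right_mono) (auto simp: K2_def)
      finally show ?thesis by simp
    qed
    \<comment> \<open>Inserting the bound on \<open>scale u\<close> puts
      \<open>scale (u @ v)\<close> on both sides; cancelling it leaves the lower bound on
      \<open>scale v\<close>.\<close>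
    have "1 * scale (u @ v) \<le> M * scale u * scale v" using scale_append_le[OF lists(1,2)] by simp
    also have "\<dots> \<le> M * (K2 * (R / r) * scale (u @ v)) * scale v"
      using ratio M_pos pos by (intro mult_right_mono mult_left_mono) auto
    also have "\<dots> = (M * K2 * (R / r) * scale v) * scale (u @ v)" by simp
    finally have "1 \<le> M * K2 * (R / r) * scale v"
      using pos(3) by (simp only: mult_le_cancel_right_pos)
    then have "1 \<le> (M * K2 * (R / r) * scale v) powr s" using \<open>s > 0\<close> by (intro ge_one_powr_ge_zero) auto
    also have "\<dots> = (M * K2) powr s * (R / r) powr s * scale v powr s"
      using M_pos \<open>K2 > 0\<close> pos \<open>0 < r\<close> \<open>r < R\<close> by (simp add: powr_mult powr_divide)
    finally have one_le: "1 \<le> (M * K2) powr s * (R / r) powr s * scale v powr s" .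
    define Q where "Q = (M * K2) powr s * (R / r) powr s"
    have "k * 1 \<le> k * (Q * scale v powr s)"
      using one_le \<open>k > 0\<close> unfolding Q_def by (intro mult_left_mono) auto
    also have "\<dots> = Q * (k * scale v powr s)" by simp
    also have "\<dots> \<le> Q * measure \<mu> (piece v)"
      by (intro mult_left_mono k lists) (auto simp: Q_def)
    finally have kv: "k \<le> Q * measure \<mu> (piece v)" by simp
    note mpos = measure_piece_pos[OF lists(1)] measure_piece_pos[OF lists(2)] measure_piece_pos[OF lists(3)]
    have "measure \<mu> (cball y R \<inter> F) / measure \<mu> (cball y r \<inter> F)
        \<le> measure \<mu> (piece u) / measure \<mu> (piece (u @ v))"
      using upper lower mpos by (intro frac_le) auto
    also have "\<dots> \<le> C / measure \<mu> (piece v)"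
      using quasi_ge[OF lists(1,2)] mpos by (simp add: field_simps)
    also have "\<dots> = C * (1 / measure \<mu> (piece v))" by simp
    also have "\<dots> \<le> C * (Q / k)"
      using kv C_ge_1 mpos \<open>k > 0\<close> by (intro mult_left_mono) (auto simp: field_simps)
    also have "\<dots> = D * (R / r) powr s" by (simp add: D_def Q_def)
    finally show ?thesis .
  qed
  ultimately show ?thesis by blast
qed

lemma exists_piece_bound: "\<exists>s>0. \<exists>k>0. \<forall>v\<in>lists \<Lambda>. k * scale v powr s \<le> measure \<mu> (piece v)"
proof -
  have "\<Lambda> \<noteq> {}" using F_eq F_nonempty by auto
  define q where "q = Min ((\<lambda>i. measure \<mu> (piece [i])) ` \<Lambda>) / C"
  have "q > 0" using \<open>\<Lambda> \<noteq> {}\<close> finite_alphabet measure_piece_pos C_ge_1 by (auto simp: q_def)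
  have qn: "q ^ length v \<le> measure \<mu> (piece v)" if "v \<in> lists \<Lambda>" for v
    using that
  proof (induction v)
    case Nil
    then show ?case using measure_piece_Nil by simp
  next
    case (Cons i v)
    then have iv: "[i] \<in> lists \<Lambda>" "v \<in> lists \<Lambda>" by auto
    have "q * q ^ length v \<le> measure \<mu> (piece [i]) / C * measure \<mu> (piece v)"
    proof (rule mult_mono)
      show "q \<le> measure \<mu> (piece [i]) / C"
        unfolding q_def using iv finite_alphabet C_ge_1 by (intro divide_right_mono Min_le) auto
    qed (use Cons iv \<open>q > 0\<close> C_ge_1 in auto)
    also have "\<dots> \<le> measure \<mu> (piece (i # v))"
      using quasi_ge[OF iv] C_ge_1 by (simp add: field_simps)
    finally show ?case by simp
  qed
  \<comment> \<open>The exponent \<open>ln q / ln c\<close> solves \<open>c powr s = q\<close>.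
    Larger exponents only decrease the power since \<open>c < 1\<close>, so the maximum with 1,
    which keeps \<open>s\<close> positive, is harmless.\<close>
  define s where "s = max 1 (ln q / ln c)"
  have "s > 0" by (simp add: s_def less_max_iff_disj)
  have "c powr s \<le> c powr (ln q / ln c)"
    using c_pos c_less_1 by (intro powr_mono') (auto simp: s_def)
  also have "\<dots> = q" using c_pos c_less_1 \<open>q > 0\<close> by (simp add: powr_def)
  finally have cq: "c powr s \<le> q" .
  define k where "k = 1 / dist x0 y0 powr s"
  have "k > 0" using dist_base_pos by (simp add: k_def)
  moreover have "k * scale v powr s \<le> measure \<mu> (piece v)" if v: "v \<in> lists \<Lambda>" for v
  proof -
    have "scale v powr s \<le> (c ^ length v * dist x0 y0) powr s"
      using scale_le[OF v] scale_pos[OF v] \<open>s > 0\<close> by (intro powr_mono2) auto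
    also have "\<dots> = (c powr s) ^ length v * dist x0 y0 powr s"
      using c_pos by (simp add: powr_mult powr_powr powr_realpow[symmetric] mult.commute)
    also have "\<dots> \<le> q ^ length v * dist x0 y0 powr s"
      using cq by (intro mult_right_mono power_mono) auto
    finally have "k * scale v powr s \<le> q ^ length v"
      using dist_base_pos by (simp add: k_def field_simps)
    then show ?thesis using qn[OF v] by linarith
  qed
  ultimately show ?thesis using \<open>s > 0\<close> by blast
qed

lemma assouad_dim_finite: "assouad_dim F \<mu> < \<infinity>"
proof -
  obtain s k where s: "s > 0" "k > 0" and k: "\<And>v. v \<in> lists \<Lambda> \<Longrightarrow> k * scale v powr s \<le> measure \<mu> (piece v)"
    using exists_piece_bound by blast
  have "assouad_dim F \<mu> \<le> ereal s"
    unfolding assouad_dim_def using piece_bound_imp_global_bound[OF s k] s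
    by (intro Inf_lower) blast
  then show ?thesis by (rule le_less_trans) simp
qed

text \<open>The exceptional null set is defined through words and does not depend on the exponent.
  Off it the two sets of admissible exponents coincide, so their infima agree with no limiting
  argument.\<close>

lemma AE_pointwise_assouad_dim_eq: "AE x in \<mu>. pointwise_assouad_dim F \<mu> x = assouad_dim F \<mu>"
  using AE_contains_all_words AE_space
proof eventually_elim
  case (elim x)
  then have x: "x \<in> F" "\<And>v. v \<in> lists \<Lambda> \<Longrightarrow> \<exists>u\<in>lists \<Lambda>. x \<in> piece (u @ v)" by (auto simp: space_\<mu>)
  define P where "P s \<longleftrightarrow> (\<exists>D>0. \<forall>r R. 0 < r \<and> r < R \<longrightarrow>
    measure \<mu> (cball x R \<inter> F) / measure \<mu> (cball x r \<inter> F) \<le> D * (R / r) powr s)" for s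
  define G where "G s \<longleftrightarrow> (\<exists>D>0. \<forall>y\<in>F. \<forall>r R. 0 < r \<and> r < R \<longrightarrow>
    measure \<mu> (cball y R \<inter> F) / measure \<mu> (cball y r \<inter> F) \<le> D * (R / r) powr s)" for s
  have "G s" if "s > 0" "P s" for s
  proof -
    obtain D where "D > 0" and D: "\<And>r R. 0 < r \<Longrightarrow> r < R \<Longrightarrow>
        measure \<mu> (cball x R \<inter> F) / measure \<mu> (cball x r \<inter> F) \<le> D * (R / r) powr s"
      using \<open>P s\<close> unfolding P_def by blast
    obtain k where "k > 0" "\<And>v. v \<in> lists \<Lambda> \<Longrightarrow> k * scale v powr s \<le> measure \<mu> (piece v)"
      using pointwise_bound_imp_piece_bound[OF x \<open>s > 0\<close> \<open>D > 0\<close> D] by blast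
    then show "G s" unfolding G_def by (rule piece_bound_imp_global_bound[OF \<open>s > 0\<close>])
  qed
  moreover have "P s" if "G s" for s using that x(1) unfolding P_def G_def by blast
  ultimately have "{ereal s | s. s > 0 \<and> P s} = {ereal s | s. s > 0 \<and> G s}" by blast
  then show ?case unfolding pointwise_assouad_dim_def assouad_dim_def P_def G_def by (rule arg_cong)
qed

end

theorem theorem4p1:
  fixes \<Lambda> :: "'i set"
    and \<phi> :: "'i \<Rightarrow> 'a::euclidean_space \<Rightarrow> 'a"
    and \<Omega> X0 F :: "'a set"
    and \<mu> :: "'a measure"
  assumes "self_conformal_ifs \<Lambda> \<phi> \<Omega> X0"
    and "is_limit_set \<Lambda> \<phi> \<Omega> F"
    and "strong_separation \<Lambda> \<phi> F"
    and "quasi_bernoulli_on \<Lambda> \<phi> F \<mu>"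
    and "fully_supported_on F \<mu>"
  shows "(AE x in \<mu>. pointwise_assouad_dim F \<mu> x = assouad_dim F \<mu>) \<and> assouad_dim F \<mu> < \<infinity>"
proof -
  obtain c K where sep: "separated_ifs \<Lambda> \<phi> F c" and "K > 0" and
    K: "\<And>w x y x' y'. w \<in> lists \<Lambda> \<Longrightarrow> x \<in> F \<Longrightarrow> y \<in> F \<Longrightarrow> x' \<in> F \<Longrightarrow> y' \<in> F \<Longrightarrow>
     dist (word_map \<phi> w x) (word_map \<phi> w y) * dist x' y'
       \<le> K * (dist (word_map \<phi> w x') (word_map \<phi> w y') * dist x y)"
    by (rule self_conformal_ifs_separated_distortion[OF assms(1-3)]) blast
  interpret separated_ifs \<Lambda> \<phi> F c by (rule sep)
  obtain C where C: "prob_space \<mu>" "sets \<mu> = sets (restrict_space borel F)" "C \<ge> 1"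
    "\<And>u v. u \<in> lists \<Lambda> \<Longrightarrow> v \<in> lists \<Lambda> \<Longrightarrow>
      measure \<mu> (piece u) * measure \<mu> (piece v) \<le> C * measure \<mu> (piece (u @ v))"
    "\<And>u v. u \<in> lists \<Lambda> \<Longrightarrow> v \<in> lists \<Lambda> \<Longrightarrow>
      measure \<mu> (piece (u @ v)) \<le> C * (measure \<mu> (piece u) * measure \<mu> (piece v))"
    by (rule quasi_bernoulli_on_pieces[OF assms(4)]) blast
  show ?thesis
  proof (cases "\<exists>p. F = {p}")
    \<comment> \<open>No two base points exist here, so \<open>scale\<close> cannot be set up. Every
      ball around the point is \<open>F\<close> itself, so the mass quotients are at most 1 and the
      exponent 1 is admissible.\<close>
    case True
    then obtain p where p: "F = {p}" by blast
    have sp: "space \<mu> = F"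
      using sets_eq_imp_space_eq[OF C(2)] by (simp add: space_restrict_space)
    have "AE x in \<mu>. pointwise_assouad_dim F \<mu> x = assouad_dim F \<mu>"
      using AE_space
    proof eventually_elim
      case (elim x)
      then have "F = {x}" using p sp by auto
      then show ?case by (simp add: pointwise_assouad_dim_def assouad_dim_def)
    qed
    moreover have "assouad_dim F \<mu> \<le> ereal 1"
    proof -
      have "measure \<mu> (cball p R \<inter> F) / measure \<mu> (cball p r \<inter> F) \<le> 1 * (R / r) powr 1"
        if "0 < r" "r < R" for r R
        using that p by (simp add: field_simps)
      then show ?thesis unfolding assouad_dim_def
        using p by (intro Inf_lower CollectI exI[of _ 1] conjI) (auto intro!: exI[of _ 1])
    qed
    ultimately show ?thesis by (auto intro: le_less_trans)
  next
    case False
    then obtain x0 y0 where "x0 \<in> F" "y0 \<in> F" "x0 \<noteq> y0" using F_nonempty by blast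
    then have "distorted_ifs \<Lambda> \<phi> F c K x0 y0"
      using K \<open>K > 0\<close> by unfold_locales
    then interpret distorted_ifs \<Lambda> \<phi> F c K x0 y0 .
    interpret prob_space \<mu> by (rule C(1))
    interpret quasi_bernoulli_ifs \<Lambda> \<phi> F c K x0 y0 \<mu> C
      by unfold_locales (fact C(2) assms(5) C(3) C(4) C(5))+
    show ?thesis using AE_pointwise_assouad_dim_eq assouad_dim_finite by blast
  qed
qed

end
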